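(* Let $1\le p<\infty$ and let $q\ge p$ be such that \[ \begin{cases} q<p^*, & \text{if } 1\le p<2,\\ q<\infty, & \text{if } p=2,\\ q\le\infty, & \text{if } p>2,\end{cases} \qquad\text{where } p^*=\frac{2p}{2-p}\ \text{ for } 1\le p<2 . \] Then there exists a constant $\Theta_{p,q}>0$ (depending only on $p$ and $q$) such that for every $k\in\mathbb{N}\setminus\{0\}$ and every open set $\Omega\subseteq\mathbb{R}^2$ that is multiply connected of order $k$ and has finite inradius $r_\Omega$, we have \[ \lambda_{p,q}(\Omega)\ \ge\ \Theta_{p,q}\,\left(\frac{1}{\sqrt{k}\,r_\Omega}\right)^{p-2+\frac{2p}{q}} . \] Moreover, the constants $\Theta_{p,q}$ can be taken so that they have the following asymptotic behaviours: (a) for every fixed $1\le p<2$, \[ 0<\lim_{q\nearrow p^*}\Theta_{p,q}<+\infty; \] (b) for $p=2$, \[ 0<\liminf_{q\nearrow\infty}\big(q\,\Theta_{2,q}\big)\le\limsup_{q\nearrow\infty}\big(q\,\Theta_{2,q}\big)<+\infty . \]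
   Context: For an open set $\Omega\subseteq\mathbb{R}^N$, the inradius is $r_\Omega=\sup\{r>0 : \text{there exists a ball } B_r(x_0)\subseteq\Omega\}$, and \[ \lambda_{p,q}(\Omega)=\inf_{u\in C^\infty_0(\Omega)\setminus\{0\}}\frac{\|\nabla u\|_{L^p(\Omega)}^p}{\|u\|_{L^q(\Omega)}^p}. \] Here $N=2$. When $q=\infty$, $1/q$ is understood as $0$. Let $(\mathbb{R}^2)^*$ be the one-point compactification of $\mathbb{R}^2$. An open connected set $\Omega\subseteq\mathbb{R}^2$ is multiply connected of order $k$ if its complement in $(\mathbb{R}^2)^*$ has exactly $k$ connected components. *)

theory Defs
  imports "HOL-Analysis.Analysis" "HOL-Probability.Essential_Supremum"
begin

primrec C_k :: "nat \<Rightarrow> ('a::euclidean_space \<Rightarrow> real) \<Rightarrow> bool" where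
  "C_k 0 u \<longleftrightarrow> continuous_on UNIV u"
| "C_k (Suc n) u \<longleftrightarrow> (\<forall>x. u differentiable (at x)) \<and>
     (\<forall>i\<in>Basis. C_k n (\<lambda>x. frechet_derivative u (at x) i))"

(* C_0^oo(Omega): functions are extended by zero to the whole space. *)
definition test_functions :: "'a::euclidean_space set \<Rightarrow> ('a \<Rightarrow> real) set" where
  "test_functions \<Omega> = {u. (\<forall>n. C_k n u) \<and>
     compact (closure {x. u x \<noteq> 0}) \<and> closure {x. u x \<noteq> 0} \<subseteq> \<Omega>}"

definition gradient :: "('a::real_inner \<Rightarrow> real) \<Rightarrow> 'a \<Rightarrow> 'a" where
  "gradient u x = (THE D. GDERIV u x :> D)"

(* Real-valued, hence only meaningful when the norm is finite.  It is applied below to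
   continuous functions with compact support only, for which this is always so. *)
definition Lp_norm :: "ereal \<Rightarrow> 'a::euclidean_space set \<Rightarrow> ('a \<Rightarrow> 'b::real_normed_vector) \<Rightarrow> real" where
  "Lp_norm q \<Omega> f =
     (if q = \<infinity> then real_of_ereal (esssup (lebesgue_on \<Omega>) (\<lambda>x. ereal (norm (f x))))
      else (LINT x|lebesgue_on \<Omega>. norm (f x) powr real_of_ereal q) powr (1 / real_of_ereal q))"

(* Extended real, so that the value is infinity when there are no nonzero test functions,
   that is, for empty Omega. *)
definition lambda_pq :: "real \<Rightarrow> ereal \<Rightarrow> 'a::euclidean_space set \<Rightarrow> ereal" where
  "lambda_pq p q \<Omega> = (INF u \<in> test_functions \<Omega> - {\<lambda>x. 0}.
     ereal (Lp_norm (ereal p) \<Omega> (gradient u) powr p / Lp_norm q \<Omega> u powr p))"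

definition inradius :: "'a::metric_space set \<Rightarrow> ennreal" where
  "inradius \<Omega> = (SUP r \<in> {r. 0 < r \<and> (\<exists>x. ball x r \<subseteq> \<Omega>)}. ennreal r)"

definition multiply_connected_of_order :: "nat \<Rightarrow> (real^2) set \<Rightarrow> bool" where
  "multiply_connected_of_order k \<Omega> \<longleftrightarrow> open \<Omega> \<and> connected \<Omega> \<and>
     (let S = Alexandroff_compactification (euclidean :: (real^2) topology);
          \<C> = connected_components_of (subtopology S (topspace S - Some ` \<Omega>))
      in finite \<C> \<and> card \<C> = k)"

definition p_star :: "real \<Rightarrow> real" where
  "p_star p = 2 * p / (2 - p)"

definition admissible :: "real \<Rightarrow> ereal \<Rightarrow> bool" where
  "admissible p q \<longleftrightarrow> 1 \<le> p \<and> ereal p \<le> q \<and>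
     (p < 2 \<longrightarrow> q < ereal (p_star p)) \<and>
     (p = 2 \<longrightarrow> q < \<infinity>) \<and>
     (p > 2 \<longrightarrow> q \<le> \<infinity>)"

end

theory Submission
  imports Defs
begin

text \<open>Everything follows from two inequalities for compactly supported \<open>C\<^sup>1\<close> functions vanishing
  off \<open>\<Omega>\<close>: the Gagliardo--Nirenberg inequality \<open>\<parallel>f\<parallel>\<^sub>2 \<le> \<parallel>\<nabla>f\<parallel>\<^sub>1\<close> and the Poincare inequality
  \<open>\<parallel>f\<parallel>\<^sub>1 \<le> C \<surd>k r \<parallel>\<nabla>f\<parallel>\<^sub>1\<close>. For the latter, tile the plane by squares of side comparable to \<open>\<surd>k r\<close>, each
  divided into at least \<open>2 k\<close> cells containing a point of the complement. At most \<open>k\<close> of these points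
  can be isolated from the others by a curve in \<open>\<Omega>\<close> close to them; near the remaining points the
  complement has a large projection to a coordinate axis. Hence a fixed fraction of the
  vertical or of the horizontal lines through the tile meets the complement, and integrating
  along these lines gives the estimate on the tile.

  Applying both inequalities to \<open>|f|\<close> raised to the power \<open>1 + q (1 - 1/p)\<close> and interpolating gives the result
  for finite \<open>q\<close>. For \<open>p = 2\<close> this constant is too large by a factor \<open>\<surd>q\<close>; applying the
  Gagliardo--Nirenberg inequality to truncations of \<open>f\<close> instead shows that the measures of the
  superlevel sets decay like a Gaussian, as in Trudinger's inequality. For \<open>p > 2\<close> the same truncations
  give a De Giorgi iteration that bounds the supremum.\<close>

section \<open>Compactly supported functions with continuous gradient\<close>

text \<open>A hole may be a single point, and almost every horizontal or vertical line misses it, so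
  a hole by itself gives no bound. A hole is useful only if all squares around it, up to a fixed
  size, meet the complement. Since at most \<open>k\<close> holes fail this, \<open>2 * k\<close>
  cells leave at least half of them useful. A tile of \<open>n * n\<close> cells with
  \<open>n\<close> of order \<open>sqrt k\<close> has side of order \<open>sqrt k * r\<close>, and
  this is the only source of \<open>sqrt k\<close>.

  The geometry is needed for the exponent 1 only, where both inequalities come from integrating a
  derivative along lines. The power \<open>1 + q * (1 - 1/p)\<close> is the one for which Hoelder's
  inequality returns the integral of \<open>|f|^q\<close> itself, so that it can be cancelled. The
  resulting constant stays bounded up to the critical exponent, which yields (a). For fixed
  \<open>p > 1\<close> it grows linearly in \<open>q\<close>: it cannot reach
  \<open>q = \<infinity>\<close>, and for \<open>p = 2\<close> it would make \<Theta> decay like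
  \<open>q^(-2)\<close> instead of \<open>q^(-1)\<close>.\<close>

definition C1_compact :: "(real \<times> real \<Rightarrow> real) \<Rightarrow> (real \<times> real \<Rightarrow> real) \<Rightarrow> bool" where
  "C1_compact f g \<longleftrightarrow> continuous_on UNIV f \<and> bounded {z. f z \<noteq> 0} \<and>
     (\<exists>f1 f2. continuous_on UNIV f1 \<and> continuous_on UNIV f2 \<and>
       (\<forall>x y. ((\<lambda>x. f (x, y)) has_real_derivative f1 (x, y)) (at x)) \<and>
       (\<forall>x y. ((\<lambda>y. f (x, y)) has_real_derivative f2 (x, y)) (at y)) \<and>
       g = (\<lambda>z. sqrt ((f1 z)\<^sup>2 + (f2 z)\<^sup>2)))"

lemma C1_compact_continuous: "C1_compact f g \<Longrightarrow> continuous_on UNIV f"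
  and C1_compact_bounded: "C1_compact f g \<Longrightarrow> bounded {z. f z \<noteq> 0}"
  and C1_compact_nonneg: "C1_compact f g \<Longrightarrow> 0 \<le> g z"
  by (auto simp: C1_compact_def)

lemma C1_compact_continuous_grad: "C1_compact f g \<Longrightarrow> continuous_on UNIV g"
  unfolding C1_compact_def
  by (auto intro!: continuous_intros)

lemma C1_compact_grad_zero:
  assumes "C1_compact f g" "z \<notin> closure {z. f z \<noteq> 0}"
  shows "g z = 0"
proof -
  obtain x y where z: "z = (x, y)" by (cases z)
  obtain f1 f2 where d1: "((\<lambda>x. f (x, y)) has_real_derivative f1 (x, y)) (at x)"
    and d2: "((\<lambda>y. f (x, y)) has_real_derivative f2 (x, y)) (at y)"
    and g: "g z = sqrt ((f1 z)\<^sup>2 + (f2 z)\<^sup>2)"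
    using assms(1) unfolding C1_compact_def by blast
  define U where "U = - closure {z. f z \<noteq> 0}"
  have U: "open U" "z \<in> U" "\<And>w. w \<in> U \<Longrightarrow> f w = 0"
    using assms(2) closure_subset[of "{z. f z \<noteq> 0}"] by (auto simp: U_def)
  have o1: "open ((\<lambda>x. (x, y)) -` U)" and o2: "open ((\<lambda>y. (x, y)) -` U)"
    by (intro open_vimage U(1) continuous_intros)+
  have "((\<lambda>x. f (x, y)) has_real_derivative 0) (at x)"
    by (rule has_field_derivative_transform_within_open[OF DERIV_const[of 0] o1]) (use U z in auto)
  then have "f1 z = 0" using DERIV_unique d1 z by blast
  moreover have "((\<lambda>y. f (x, y)) has_real_derivative 0) (at y)"
    by (rule has_field_derivative_transform_within_open[OF DERIV_const[of 0] o2]) (use U z in auto)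
  then have "f2 z = 0" using DERIV_unique d2 z by blast
  ultimately show ?thesis using g by simp
qed

lemma C1_compact_bounded_grad:
  assumes "C1_compact f g" shows "bounded {z. g z \<noteq> 0}"
  by (rule bounded_subset[OF bounded_closure[OF C1_compact_bounded[OF assms]]])
     (use C1_compact_grad_zero[OF assms] in auto)

text \<open>This produces the powers and the truncations of \<open>f\<close>. The condition
  \<open>\<psi> 0 = 0\<close> keeps the support bounded, and the absolute value is there because
  \<open>g\<close> carries only the length of the gradient.\<close>

lemma C1_compact_compose:
  assumes f: "C1_compact f g"
    and \<psi>: "\<And>s. (\<psi> has_real_derivative \<psi>' s) (at s)" "continuous_on UNIV \<psi>'" "\<psi> 0 = 0"
  shows "C1_compact (\<lambda>z. \<psi> (f z)) (\<lambda>z. \<bar>\<psi>' (f z)\<bar> * g z)"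
proof -
  obtain f1 f2 where c: "continuous_on UNIV f1" "continuous_on UNIV f2"
    and d1: "\<And>x y. ((\<lambda>x. f (x, y)) has_real_derivative f1 (x, y)) (at x)"
    and d2: "\<And>x y. ((\<lambda>y. f (x, y)) has_real_derivative f2 (x, y)) (at y)"
    and g: "\<And>z. g z = sqrt ((f1 z)\<^sup>2 + (f2 z)\<^sup>2)"
    using f unfolding C1_compact_def by blast
  have cf: "continuous_on UNIV f" by (rule C1_compact_continuous[OF f])
  have c\<psi>: "continuous_on UNIV \<psi>"
    using \<psi>(1) DERIV_isCont by (auto simp: continuous_on_eq_continuous_at)
  have cc: "continuous_on UNIV (\<lambda>z. \<psi>' (f z))" "continuous_on UNIV (\<lambda>z. \<psi> (f z))"
    by (rule continuous_on_compose2[OF \<psi>(2) cf] continuous_on_compose2[OF c\<psi> cf]; simp)+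
  have b: "bounded {z. \<psi> (f z) \<noteq> 0}"
    by (rule bounded_subset[OF C1_compact_bounded[OF f]]) (use \<psi>(3) in auto)
  have d: "\<forall>x y. ((\<lambda>x. \<psi> (f (x, y))) has_real_derivative \<psi>' (f (x, y)) * f1 (x, y)) (at x)"
      "\<forall>x y. ((\<lambda>y. \<psi> (f (x, y))) has_real_derivative \<psi>' (f (x, y)) * f2 (x, y)) (at y)"
    using DERIV_chain2[OF \<psi>(1) d1] DERIV_chain2[OF \<psi>(1) d2] by blast+
  have e: "(\<lambda>z. \<bar>\<psi>' (f z)\<bar> * g z) = (\<lambda>z. sqrt ((\<psi>' (f z) * f1 z)\<^sup>2 + (\<psi>' (f z) * f2 z)\<^sup>2))"
    by (simp add: g power_mult_distrib real_sqrt_mult flip: distrib_left)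
  show ?thesis
    unfolding C1_compact_def
    using b d e cc continuous_on_mult[OF cc(1) c(1)] continuous_on_mult[OF cc(1) c(2)] by blast
qed

section \<open>Line integrals and the Gagliardo-Nirenberg inequality\<close>

lemma abs_diff_le_nn_integral:
  fixes F :: "real \<Rightarrow> real"
  assumes F: "\<And>t. (F has_real_derivative F' t) (at t)" "continuous_on UNIV F'"
    and G: "\<And>t. \<bar>F' t\<bar> \<le> G t" and x: "x \<in> {a..b}" "x' \<in> {a..b}"
  shows "ennreal \<bar>F x - F x'\<bar> \<le> (\<integral>\<^sup>+t. ennreal (G t) * indicator {a..<b} t \<partial>lborel)"
proof -
  have *: "ennreal \<bar>F v - F u\<bar> \<le> (\<integral>\<^sup>+t. ennreal (G t) * indicator {a..<b} t \<partial>lborel)"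
    if "u \<le> v" "u \<in> {a..b}" "v \<in> {a..b}" for u v
  proof -
    have hb: "has_bochner_integral lborel (\<lambda>t. F' t * indicator {u..v} t) (F v - F u)"
      by (rule has_bochner_integral_FTC_Icc_real[OF that(1)])
         (use F in \<open>auto simp: continuous_on_eq_continuous_at\<close>)
    have "ennreal (norm (\<integral>t. F' t * indicator {u..v} t \<partial>lborel))
        \<le> (\<integral>\<^sup>+t. ennreal (norm (F' t * indicator {u..v} t)) \<partial>lborel)"
      using hb by (intro integral_norm_bound_ennreal) (auto simp: has_bochner_integral_iff)
    \<comment> \<open>Half-open intervals make neighbouring tiles disjoint; leaving out the endpoint
      \<open>b\<close> costs only a null set, so the two points may still be endpoints.\<close>
    also have "\<dots> \<le> (\<integral>\<^sup>+t. ennreal (G t) * indicator {a..<b} t \<partial>lborel)"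
      by (rule nn_integral_mono_AE, use AE_lborel_singleton[of b] in eventually_elim)
         (use G that in \<open>auto simp: indicator_def intro: ennreal_leI\<close>)
    finally show ?thesis using hb by (simp add: has_bochner_integral_iff)
  qed
  show ?thesis
    using *[of x x'] *[of x' x] x by (cases "x \<le> x'") (auto simp: abs_minus_commute)
qed

lemma C1_compact_horizontal:
  assumes "C1_compact f g" "x \<in> {a..b}" "x' \<in> {a..b}"
  shows "ennreal \<bar>f (x, y) - f (x', y)\<bar> \<le> (\<integral>\<^sup>+t. ennreal (g (t, y)) * indicator {a..<b} t \<partial>lborel)"
proof -
  obtain f1 f2 where c: "continuous_on UNIV f1"
    and d1: "\<And>x y. ((\<lambda>x. f (x, y)) has_real_derivative f1 (x, y)) (at x)"
    and g: "\<And>z. g z = sqrt ((f1 z)\<^sup>2 + (f2 z)\<^sup>2)"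
    using assms(1) unfolding C1_compact_def by blast
  have "continuous_on UNIV (\<lambda>t. f1 (t, y))"
    by (rule continuous_on_compose2[OF c]) (auto intro!: continuous_intros)
  then show ?thesis
    by (rule abs_diff_le_nn_integral[of "\<lambda>t. f (t, y)", OF d1 _ _ assms(2,3)])
       (subst g, rule real_sqrt_ge_abs1)
qed

lemma C1_compact_vertical:
  assumes "C1_compact f g" "y \<in> {a..b}" "y' \<in> {a..b}"
  shows "ennreal \<bar>f (x, y) - f (x, y')\<bar> \<le> (\<integral>\<^sup>+t. ennreal (g (x, t)) * indicator {a..<b} t \<partial>lborel)"
proof -
  obtain f1 f2 where c: "continuous_on UNIV f2"
    and d1: "\<And>x y. ((\<lambda>y. f (x, y)) has_real_derivative f2 (x, y)) (at y)"
    and g: "\<And>z. g z = sqrt ((f1 z)\<^sup>2 + (f2 z)\<^sup>2)"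
    using assms(1) unfolding C1_compact_def by blast
  have "continuous_on UNIV (\<lambda>t. f2 (x, t))"
    by (rule continuous_on_compose2[OF c]) (auto intro!: continuous_intros)
  then show ?thesis
    by (rule abs_diff_le_nn_integral[of "\<lambda>t. f (x, t)", OF d1 _ _ assms(2,3)])
       (subst g, rule real_sqrt_ge_abs2)
qed

lemma nn_integral_lborel_pair:
  assumes [measurable]: "F \<in> borel_measurable (borel :: (real \<times> real) measure)"
  shows "(\<integral>\<^sup>+x. \<integral>\<^sup>+y. F (x, y) \<partial>lborel \<partial>lborel) = (\<integral>\<^sup>+z. F z \<partial>lborel)"
    and "(\<integral>\<^sup>+y. \<integral>\<^sup>+x. F (x, y) \<partial>lborel \<partial>lborel) = (\<integral>\<^sup>+z. F z \<partial>lborel)"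
proof -
  have m: "F \<in> borel_measurable (lborel \<Otimes>\<^sub>M lborel)"
    by (simp add: lborel_prod)
  show "(\<integral>\<^sup>+x. \<integral>\<^sup>+y. F (x, y) \<partial>lborel \<partial>lborel) = (\<integral>\<^sup>+z. F z \<partial>lborel)"
    using lborel.nn_integral_fst[OF m] by (simp add: lborel_prod)
  show "(\<integral>\<^sup>+y. \<integral>\<^sup>+x. F (x, y) \<partial>lborel \<partial>lborel) = (\<integral>\<^sup>+z. F z \<partial>lborel)"
    using lborel_pair.nn_integral_snd[OF m] by (simp add: lborel_prod)
qed

text \<open>Integrating along the horizontal line bounds \<open>|f|\<close> by a function of
  \<open>y\<close> alone, along the vertical line by a function of \<open>x\<close> alone. The
  integral of the product of the two bounds factorises.\<close>

lemma gagliardo_nirenberg: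
  assumes fg: "C1_compact f g"
  shows "(\<integral>\<^sup>+z. ennreal ((f z)\<^sup>2) \<partial>lborel) \<le> (\<integral>\<^sup>+z. ennreal (g z) \<partial>lborel)\<^sup>2"
proof -
  obtain B where B: "\<And>z. f z \<noteq> 0 \<Longrightarrow> norm z \<le> B"
    using C1_compact_bounded[OF fg] by (auto simp: bounded_iff)
  have gm[measurable]: "g \<in> borel_measurable borel"
    by (rule borel_measurable_continuous_onI[OF C1_compact_continuous_grad[OF fg]])
  have fm[measurable]: "f \<in> borel_measurable borel"
    by (rule borel_measurable_continuous_onI[OF C1_compact_continuous[OF fg]])
  define H where "H y = (\<integral>\<^sup>+t. ennreal (g (t, y)) \<partial>lborel)" for y
  define V where "V x = (\<integral>\<^sup>+t. ennreal (g (x, t)) \<partial>lborel)" for x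
  have Vm[measurable]: "V \<in> borel_measurable borel"
    unfolding V_def by measurable
  have Hm[measurable]: "H \<in> borel_measurable borel"
    unfolding H_def by measurable
  have fH: "ennreal \<bar>f (x, y)\<bar> \<le> H y" for x y
  proof -
    \<comment> \<open>Far enough to the right to be outside the support, so that
      \<open>f (c, y) = 0\<close>.\<close>
    define c where "c = \<bar>x\<bar> + \<bar>B\<bar> + 1"
    have in_c: "x \<in> {-c..c}" "c \<in> {-c..c}"
      by (auto simp: c_def)
    have "f (c, y) = 0"
      using B[of "(c, y)"] norm_fst_le[of c y] by (fastforce simp: c_def)
    then have "ennreal \<bar>f (x, y)\<bar> \<le> (\<integral>\<^sup>+t. ennreal (g (t, y)) * indicator {-c..<c} t \<partial>lborel)"
      using C1_compact_horizontal[OF fg, of x "-c" c c y] in_c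
      by simp
    also have "\<dots> \<le> H y" unfolding H_def
      by (rule nn_integral_mono) (auto simp: indicator_def)
    finally show ?thesis .
  qed
  have fV: "ennreal \<bar>f (x, y)\<bar> \<le> V x" for x y
  proof -
    define c where "c = \<bar>y\<bar> + \<bar>B\<bar> + 1"
    have in_c: "y \<in> {-c..c}" "c \<in> {-c..c}"
      by (auto simp: c_def)
    have "f (x, c) = 0"
      using B[of "(x, c)"] norm_snd_le[of c x] by (fastforce simp: c_def)
    then have "ennreal \<bar>f (x, y)\<bar> \<le> (\<integral>\<^sup>+t. ennreal (g (x, t)) * indicator {-c..<c} t \<partial>lborel)"
      using C1_compact_vertical[OF fg, of y "-c" c c x] in_c
      by simp
    also have "\<dots> \<le> V x" unfolding V_def
      by (rule nn_integral_mono) (auto simp: indicator_def)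
    finally show ?thesis .
  qed
  have "(\<integral>\<^sup>+z. ennreal ((f z)\<^sup>2) \<partial>lborel) = (\<integral>\<^sup>+x. \<integral>\<^sup>+y. ennreal ((f (x, y))\<^sup>2) \<partial>lborel \<partial>lborel)"
    by (rule nn_integral_lborel_pair(1)[symmetric]) measurable
  also have "\<dots> \<le> (\<integral>\<^sup>+x. \<integral>\<^sup>+y. V x * H y \<partial>lborel \<partial>lborel)"
  proof (intro nn_integral_mono)
    fix x y
    have "ennreal ((f (x, y))\<^sup>2) = ennreal \<bar>f (x, y)\<bar> * ennreal \<bar>f (x, y)\<bar>"
      by (simp add: power2_eq_square flip: ennreal_mult)
    then show "ennreal ((f (x, y))\<^sup>2) \<le> V x * H y"
      using mult_mono[OF fV fH] by simp
  qed
  also have "\<dots> = (\<integral>\<^sup>+x. V x \<partial>lborel) * (\<integral>\<^sup>+y. H y \<partial>lborel)"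
    by (simp add: nn_integral_cmult nn_integral_multc)
  also have "\<dots> = (\<integral>\<^sup>+z. ennreal (g z) \<partial>lborel)\<^sup>2"
    using nn_integral_lborel_pair[of "\<lambda>z. ennreal (g z)"]
    by (simp add: V_def H_def power2_eq_square)
  finally show ?thesis .
qed

section \<open>The Poincare inequality in a multiply connected domain\<close>

text \<open>As the frontier of \<open>U z\<close> lies in \<Omega>, the set \<open>U z\<close> and
  the exterior of its closure split the complement in the sphere into two relatively open pieces.
  The component of \<open>z\<close> therefore stays in \<open>U z\<close>, and different points of
  \<open>Z\<close> have different components. The sets \<open>U z\<close> may overlap; only the
  other points of \<open>Z\<close> have to stay outside.\<close>

lemma card_separated_le_order:
  fixes \<Omega> :: "(real^2) set"
  assumes \<Omega>: "multiply_connected_of_order k \<Omega>"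
    and U: "\<And>z. z \<in> Z \<Longrightarrow> z \<notin> \<Omega> \<and> z \<in> U z \<and> open (U z) \<and> bounded (U z) \<and> frontier (U z) \<subseteq> \<Omega>"
    and sep: "\<And>z z'. z \<in> Z \<Longrightarrow> z' \<in> Z \<Longrightarrow> z \<noteq> z' \<Longrightarrow> z' \<notin> U z"
  shows "card Z \<le> k"
proof -
  define S where "S = Alexandroff_compactification (euclidean :: (real^2) topology)"
  define X where "X = subtopology S (topspace S - Some ` \<Omega>)"
  have fin: "finite (connected_components_of X)" and card: "card (connected_components_of X) = k"
    using \<Omega> by (auto simp: multiply_connected_of_order_def S_def X_def Let_def)
  have inX: "Some z \<in> topspace X" if "z \<in> Z" for z
    using U[OF that] by (auto simp: X_def S_def)
  have "inj_on (\<lambda>z. connected_component_of_set X (Some z)) Z"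
  proof (intro inj_onI, rule ccontr)
    fix z z' assume z: "z \<in> Z" "z' \<in> Z" "z \<noteq> z'"
      and eq: "connected_component_of_set X (Some z) = connected_component_of_set X (Some z')"
    define C where "C = connected_component_of_set X (Some z)"
    have C: "connectedin X C" "Some z \<in> C" "Some z' \<in> C"
      using inX z eq connected_component_of_refl[of X "Some z"] connected_component_of_refl[of X "Some z'"]
      unfolding C_def by (auto simp: connectedin_connected_component_of)
    have CS: "connectedin S C" "C \<inter> Some ` \<Omega> = {}"
      using C(1) by (auto simp: X_def connectedin_subtopology)
    have sub: "C \<subseteq> insert None (Some ` (- \<Omega>))"
    proof
      fix x assume "x \<in> C"
      then show "x \<in> insert None (Some ` (- \<Omega>))"
        using CS by (cases x) auto
    qed
    define E1 where "E1 = Some ` U z"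
    \<comment> \<open>Infinity lies on the outer side. \<open>E2\<close> is open in the sphere
      because the bounded set \<open>U z\<close> has a compact closure.\<close>
    define E2 where "E2 = insert None (Some ` (- closure (U z)))"
    have "openin S E1"
      using U[OF z(1)] by (auto simp: S_def openin_Alexandroff_compactification E1_def)
    moreover have "openin S E2"
      unfolding S_def openin_Alexandroff_compactification E2_def
      using U[OF z(1)] by (intro disjI2 exI[of _ "closure (U z)"]) (auto simp: Compl_eq_Diff_UNIV)
    moreover have fr: "closure (U z) - U z \<subseteq> \<Omega>"
      using U[OF z(1)] by (auto simp: frontier_def interior_open)
    moreover have "C \<subseteq> E1 \<union> E2"
      using sub fr by (auto simp: E1_def E2_def)
    moreover have "E1 \<inter> E2 \<inter> C = {}"
      using closure_subset[of "U z"] by (auto simp: E1_def E2_def)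
    moreover have "E1 \<inter> C \<noteq> {}"
      using C U[OF z(1)] by (auto simp: E1_def)
    moreover have "E2 \<inter> C \<noteq> {}"
      using C fr U[OF z(2)] sep[OF z] by (auto simp: E2_def)
    ultimately show False
      using connectedinD[OF CS(1)] by blast
  qed
  moreover have "(\<lambda>z. connected_component_of_set X (Some z)) ` Z \<subseteq> connected_components_of X"
    using inX by (auto simp: connected_components_of_def)
  ultimately show ?thesis
    using card_inj_on_le fin card by blast
qed

section \<open>Holes of the domain in the cells of a square tile\<close>

abbreviation sup_dist :: "real \<times> real \<Rightarrow> real \<times> real \<Rightarrow> real" where
  "sup_dist z w \<equiv> max \<bar>fst w - fst z\<bar> \<bar>snd w - snd z\<bar>"

text \<open>This separates the topology from the estimates: holes exist everywhere at scale
  \<open>d\<close>, and few of them can be enclosed by squares whose boundary lies in \<Omega>. The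
  maximum norm is used because a point at distance \<sigma> has a coordinate that is off by exactly
  \<sigma>, which a projection to an axis detects.\<close>

locale perforated_plane =
  fixes \<Omega> :: "(real \<times> real) set" and k :: nat and d :: real
  assumes open_\<Omega>: "open \<Omega>"
    and d_pos: "0 < d"
    and hole_near: "\<exists>z. z \<notin> \<Omega> \<and> sup_dist c z < d"
    and separated_holes: "finite Z \<Longrightarrow>
      (\<And>z. z \<in> Z \<Longrightarrow> z \<notin> \<Omega> \<and> 0 < \<sigma> z \<and> (\<forall>w. sup_dist z w = \<sigma> z \<longrightarrow> w \<in> \<Omega>)) \<Longrightarrow>
      (\<And>z w. z \<in> Z \<Longrightarrow> w \<in> Z \<Longrightarrow> z \<noteq> w \<Longrightarrow> \<sigma> z \<le> sup_dist z w) \<Longrightarrow> card Z \<le> k"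
begin

text \<open>If some concentric square around a hole lies in \<open>\<Omega>\<close>, it separates that hole from the
  others, so at most \<open>k\<close> of the \<open>n * n\<close> cells of the tile have such a hole. In every other cell each
  concentric square around the hole meets the complement, so the two projections of the complement
  within the cell have total length at least \<open>d / 2\<close>.\<close>

lemma tile_projections:
  fixes a b :: real and n :: nat
  assumes n: "2 * k \<le> n * n"
  defines "L \<equiv> 4 * d * real n"
  defines "E \<equiv> fst ` (cbox (a, b) (a + L, b + L) - \<Omega>)"
  defines "F \<equiv> snd ` (cbox (a, b) (a + L, b + L) - \<Omega>)"
  shows "L / 16 \<le> measure lebesgue (E \<inter> {a..<a + L}) + measure lebesgue (F \<inter> {b..<b + L})"
proof -
  define I where "I i = {a + 4 * d * real i..<a + 4 * d * (real i + 1)}" for i :: nat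
  define J where "J i = {b + 4 * d * real i..<b + 4 * d * (real i + 1)}" for i :: nat
  define G where "G = {..<n} \<times> {..<n}"
  have "compact (cbox (a, b) (a + L, b + L) - \<Omega>)"
    by (intro compact_diff compact_cbox open_\<Omega>)
  then have cE: "compact E" and cF: "compact F"
    unfolding E_def F_def by (auto intro!: compact_continuous_image continuous_intros)
  have mE: "E \<inter> {u..<v} \<in> lmeasurable" and mF: "F \<inter> {u..<v} \<in> lmeasurable" for u v
    using fmeasurable_Int_fmeasurable[OF lmeasurable_compact, of _ "{u..<v}"] cE cF by auto
  \<comment> \<open>The cells have side \<open>4 * d\<close> and each hole is within
    \<open>d\<close> of the centre of its cell. A square of half-side below \<open>d\<close> about
    the hole thus stays in the cell, and holes of different cells are at least \<open>2 * d\<close>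
    apart.\<close>
  have "\<exists>z. z \<notin> \<Omega> \<and> \<bar>fst z - (a + 4 * d * real i + 2 * d)\<bar> < d
      \<and> \<bar>snd z - (b + 4 * d * real j + 2 * d)\<bar> < d" for i j :: nat
    using hole_near[of "(a + 4 * d * real i + 2 * d, b + 4 * d * real j + 2 * d)"] by auto
  then have "\<forall>p. \<exists>z. z \<notin> \<Omega> \<and> \<bar>fst z - (a + 4 * d * real (fst p) + 2 * d)\<bar> < d
      \<and> \<bar>snd z - (b + 4 * d * real (snd p) + 2 * d)\<bar> < d"
    by blast
  then obtain z where z: "\<And>p. z p \<notin> \<Omega>"
      "\<And>p. \<bar>fst (z p) - (a + 4 * d * real (fst p) + 2 * d)\<bar> < d"
      "\<And>p. \<bar>snd (z p) - (b + 4 * d * real (snd p) + 2 * d)\<bar> < d"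
    by metis
  have far: "2 * d \<le> \<bar>x - y\<bar>"
    if "i \<noteq> j" "\<bar>x - (c + 4 * d * real i + 2 * d)\<bar> < d" "\<bar>y - (c + 4 * d * real j + 2 * d)\<bar> < d"
    for i j :: nat and x y c
  proof -
    have "4 * d * 1 \<le> 4 * d * \<bar>real i - real j\<bar>"
      using that(1) d_pos by (intro mult_left_mono) auto
    also have "\<dots> = \<bar>4 * d * real i - 4 * d * real j\<bar>"
      using d_pos by (simp add: abs_mult flip: right_diff_distrib)
    finally show ?thesis using that(2,3) by linarith
  qed
  have sep: "2 * d \<le> sup_dist (z p) (z q)" if "p \<noteq> q" for p q
    using that far[OF _ z(2) z(2), of q p] far[OF _ z(3) z(3), of q p]
    by (cases "fst p = fst q") (auto simp: prod_eq_iff le_max_iff_disj)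
  define lonely where "lonely w \<sigma> \<longleftrightarrow> 0 < \<sigma> \<and> \<sigma> < d \<and> (\<forall>v. sup_dist w v = \<sigma> \<longrightarrow> v \<in> \<Omega>)" for w \<sigma>
  define B where "B = {p \<in> G. \<exists>\<sigma>. lonely (z p) \<sigma>}"
  have finG: "finite G" "card G = n * n"
    by (auto simp: G_def)
  define s where "s w = (SOME \<sigma>. lonely w \<sigma>)" for w
  have s: "lonely (z p) (s (z p))" if "p \<in> B" for p
    using that unfolding B_def s_def by (auto intro: someI)
  have "card (z ` B) \<le> k"
  proof (rule separated_holes[of _ s])
    fix w assume "w \<in> z ` B"
    then obtain p where p: "p \<in> B" "w = z p" by blast
    show "w \<notin> \<Omega> \<and> 0 < s w \<and> (\<forall>v. sup_dist w v = s w \<longrightarrow> v \<in> \<Omega>)"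
      using s[OF p(1)] z(1)[of p] unfolding lonely_def p(2) by blast
    fix v assume v: "v \<in> z ` B" "w \<noteq> v"
    then obtain q where q: "v = z q" by blast
    have "2 * d \<le> sup_dist w v"
      unfolding p(2) q by (rule sep) (use v p q in auto)
    moreover have "s w < d"
      using s[OF p(1)] unfolding lonely_def p(2) by blast
    ultimately show "s w \<le> sup_dist w v"
      using d_pos by linarith
  qed (use finG in \<open>auto simp: B_def\<close>)
  moreover have "inj_on z B"
    using sep d_pos by (intro inj_onI) (metis abs_zero diff_self max.idem mult_pos_pos not_le zero_less_numeral)
  ultimately have cB: "card B \<le> k"
    by (simp add: card_image)
  have good: "d \<le> 2 * measure lebesgue (E \<inter> I i) + 2 * measure lebesgue (F \<inter> J j)"
    if p: "(i, j) \<in> G - B" for i j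
  proof -
    obtain x y where xy: "z (i, j) = (x, y)" by (cases "z (i, j)")
    have x: "a + 4 * d * real i + d < x" "x < a + 4 * d * real i + 3 * d"
      and y: "b + 4 * d * real j + d < y" "y < b + 4 * d * real j + 3 * d"
      using z(2,3)[of "(i, j)"] xy by auto
    have ij: "4 * d * (real i + 1) \<le> L" "4 * d * (real j + 1) \<le> L" "0 \<le> 4 * d * real i" "0 \<le> 4 * d * real j"
      using p d_pos by (auto simp: L_def G_def)
    let ?A = "(\<lambda>t. t - x) ` (E \<inter> I i)" and ?A' = "(\<lambda>t. x - t) ` (E \<inter> I i)"
    let ?B = "(\<lambda>t. t - y) ` (F \<inter> J j)" and ?B' = "(\<lambda>t. y - t) ` (F \<inter> J j)"
    have tr: "(\<lambda>t. t - c) ` S \<in> lmeasurable \<and> measure lebesgue ((\<lambda>t. t - c) ` S) = measure lebesgue S \<and>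
        (\<lambda>t. c - t) ` S \<in> lmeasurable \<and> measure lebesgue ((\<lambda>t. c - t) ` S) = measure lebesgue S"
      if "S \<in> lmeasurable" for S and c :: real
    proof -
      have "(uminus :: real \<Rightarrow> real) = (*\<^sub>R) (- 1)"
        by auto
      then have uminus: "uminus \<in> lebesgue \<rightarrow>\<^sub>M (lebesgue :: real measure)"
        using lebesgue_measurable_scaling[of "- 1", where 'a = real] by metis
      have "uminus ` S = uminus -` S"
        by (auto simp: image_iff) (metis minus_minus)
      moreover have "uminus -` S \<inter> space lebesgue \<in> sets lebesgue"
        using that by (intro measurable_sets[OF uminus]) auto
      moreover have "emeasure lebesgue (uminus ` S) = emeasure lebesgue S"
        using emeasure_lebesgue_affine[of "-1" 0 S] by simp
      ultimately have "uminus ` S \<in> lmeasurable" "measure lebesgue (uminus ` S) = measure lebesgue S"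
        using that by (auto simp: fmeasurable_def measure_def)
      moreover have "(\<lambda>t. t - c) = (+) (- c)" "(\<lambda>t. c - t) ` S = (+) c ` (uminus ` S)"
        by (auto simp: image_image)
      ultimately show ?thesis
        using that measurable_translation measure_translation by (metis)
    qed
    have m: "E \<inter> I i \<in> lmeasurable" "F \<inter> J j \<in> lmeasurable"
      using mE mF by (auto simp: I_def J_def)
    \<comment> \<open>Each \<sigma> below \<open>d\<close> is a coordinate difference, of either
      sign, between the hole and a point of the complement. The four translated and reflected
      projections therefore cover the interval, and each projection is counted twice.\<close>
    have "{0<..<d} \<subseteq> (?A \<union> ?A') \<union> (?B \<union> ?B')"
    proof
      fix \<sigma> assume \<sigma>: "\<sigma> \<in> {0<..<d}"
      then have "\<not> lonely (x, y) \<sigma>"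
        using p xy by (auto simp: B_def)
      then obtain u v where uv: "(u, v) \<notin> \<Omega>" "max \<bar>u - x\<bar> \<bar>v - y\<bar> = \<sigma>"
        using \<sigma> by (auto simp: lonely_def)
      have ux: "\<bar>u - x\<bar> < d" and vy: "\<bar>v - y\<bar> < d"
        using uv \<sigma> by auto
      have uI: "u \<in> I i" using ux x unfolding I_def by (auto simp: algebra_simps)
      have vJ: "v \<in> J j" using vy y unfolding J_def by (auto simp: algebra_simps)
      have "(u, v) \<in> cbox (a, b) (a + L, b + L)"
        using uI vJ ij unfolding I_def J_def by (auto simp flip: cbox_Pair_iff)
      then have "u \<in> E \<inter> I i" "v \<in> F \<inter> J j"
        using uv uI vJ unfolding E_def F_def by force+
      moreover have "\<sigma> = u - x \<or> \<sigma> = x - u \<or> \<sigma> = v - y \<or> \<sigma> = y - v"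
        using uv by linarith
      ultimately show "\<sigma> \<in> (?A \<union> ?A') \<union> (?B \<union> ?B')"
        by blast
    qed
    then have "measure lebesgue {0<..<d} \<le> measure lebesgue ((?A \<union> ?A') \<union> (?B \<union> ?B'))"
      using tr m by (intro measure_mono_fmeasurable fmeasurable.Un) auto
    also have "\<dots> \<le> measure lebesgue (?A \<union> ?A') + measure lebesgue (?B \<union> ?B')"
      using tr m by (intro measure_Un_le fmeasurableD fmeasurable.Un) auto
    also have "\<dots> \<le> (measure lebesgue ?A + measure lebesgue ?A') + (measure lebesgue ?B + measure lebesgue ?B')"
      using tr m by (intro add_mono measure_Un_le fmeasurableD) auto
    finally show ?thesis
      using tr m d_pos by simp
  qed
  have slices: "(\<Sum>i<n. measure lebesgue (S \<inter> {c + 4 * d * real i..<c + 4 * d * (real i + 1)}))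
      \<le> measure lebesgue (S \<inter> {c..<c + L})" if "compact S" for S and c :: real
  proof -
    let ?K = "\<lambda>i::nat. {c + 4 * d * real i..<c + 4 * d * (real i + 1)}"
    have m: "S \<inter> {u..<v} \<in> lmeasurable" for u v
      using fmeasurable_Int_fmeasurable[OF lmeasurable_compact, of _ "{u..<v}"] that by auto
    have dis: "disjnt (S \<inter> ?K i) (S \<inter> ?K j)" if "i < j" for i j
    proof -
      have "4 * d * (real i + 1) \<le> 4 * d * real j"
        using that d_pos by (intro mult_left_mono) auto
      then show ?thesis by (auto simp: disjnt_def)
    qed
    have "(\<Sum>i<n. measure lebesgue (S \<inter> ?K i)) = measure lebesgue (\<Union>i<n. S \<inter> ?K i)"
      using m dis by (intro measure_UNION'[symmetric])
        (auto simp: pairwise_def, metis disjnt_sym nat_neq_iff)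
    also have "\<dots> \<le> measure lebesgue (S \<inter> {c..<c + L})"
    proof (intro measure_mono_fmeasurable m)
      have "4 * d * (real i + 1) \<le> L" "0 \<le> 4 * d * real i" if "i < n" for i
        using that d_pos by (auto simp: L_def)
      then show "(\<Union>i<n. S \<inter> ?K i) \<subseteq> S \<inter> {c..<c + L}"
        by fastforce
      show "(\<Union>i<n. S \<inter> ?K i) \<in> sets lebesgue"
        using m by (intro sets.finite_UN fmeasurableD) auto
    qed
    finally show ?thesis .
  qed
  define e where "e = measure lebesgue (E \<inter> {a..<a + L})"
  define f where "f = measure lebesgue (F \<inter> {b..<b + L})"
  \<comment> \<open>At least half of the cells are good. In the sum over all cells each slice of
    \<open>E\<close> or \<open>F\<close> occurs \<open>n\<close> times, so
    \<open>n * n / 2 * d\<close> is at most \<open>2 * n * (e + f)\<close>; with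
    \<open>L = 4 * d * n\<close> this gives the factor 16.\<close>
  have "real (n * n) / 2 * d \<le> (real (card G) - real (card B)) * d"
    using cB n finG d_pos by (intro mult_right_mono) (auto simp flip: of_nat_mult)
  also have "real (card G) - real (card B) = real (card (G - B))"
  proof -
    have "B \<subseteq> G" by (auto simp: B_def)
    then show ?thesis
      using finite_subset[OF _ finG(1)] card_mono[OF finG(1)]
      by (simp add: card_Diff_subset of_nat_diff)
  qed
  also have "real (card (G - B)) * d = (\<Sum>(i, j)\<in>G - B. d)"
    by simp
  also have "\<dots> \<le> (\<Sum>(i, j)\<in>G - B. 2 * measure lebesgue (E \<inter> I i) + 2 * measure lebesgue (F \<inter> J j))"
    using good by (intro sum_mono) auto
  also have "\<dots> \<le> (\<Sum>(i, j)\<in>G. 2 * measure lebesgue (E \<inter> I i) + 2 * measure lebesgue (F \<inter> J j))"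
    using finG by (intro sum_mono2) auto
  also have "\<dots> = 2 * real n * ((\<Sum>i<n. measure lebesgue (E \<inter> I i)) + (\<Sum>j<n. measure lebesgue (F \<inter> J j)))"
    unfolding G_def by (simp add: sum.cartesian_product[symmetric] sum.distrib sum_distrib_left algebra_simps)
  also have "\<dots> \<le> 2 * real n * (e + f)"
    using slices[OF cE, of a] slices[OF cF, of b] unfolding e_def f_def I_def J_def
    by (intro mult_left_mono add_mono) auto
  finally have *: "real n * (real n * d) \<le> real n * (4 * (e + f))"
    by (simp add: algebra_simps)
  then have "n = 0 \<or> real n * d \<le> 4 * (e + f)"
    by (cases "n = 0") auto
  moreover have "0 \<le> e" "0 \<le> f"
    by (auto simp: e_def f_def)
  ultimately show ?thesis
    unfolding e_def[symmetric] f_def[symmetric] by (auto simp: L_def mult.commute[of d])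
qed

end

text \<open>A point is joined to a zero of \<open>f\<close> by a horizontal segment to a column over \<open>E\<close>, followed by
  a vertical segment inside that column; averaging over the columns gives the estimate.\<close>

lemma strip_poincare:
  assumes fg: "C1_compact f g" and L: "0 < L" "0 \<le> c"
    and E: "E \<in> sets borel" "E \<subseteq> {a..<a + L}" "ennreal L \<le> ennreal c * emeasure lborel E"
    and zero: "\<And>x. x \<in> E \<Longrightarrow> \<exists>y\<in>{b..b + L}. f (x, y) = 0"
  defines "Q \<equiv> {a..<a + L} \<times> {b..<b + L}"
  shows "(\<integral>\<^sup>+z. ennreal \<bar>f z\<bar> * indicator Q z \<partial>lborel)
    \<le> ennreal ((1 + c) * L) * (\<integral>\<^sup>+z. ennreal (g z) * indicator Q z \<partial>lborel)"
proof -
  have gm[measurable]: "g \<in> borel_measurable borel"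
    by (rule borel_measurable_continuous_onI[OF C1_compact_continuous_grad[OF fg]])
  have fm[measurable]: "f \<in> borel_measurable borel"
    by (rule borel_measurable_continuous_onI[OF C1_compact_continuous[OF fg]])
  note E(1)[measurable]
  have Qm[measurable]: "Q \<in> sets borel"
    unfolding Q_def by (intro borel_Times) auto
  let ?I = "{a..<a + L}" and ?J = "{b..<b + L}"
  have indQ: "indicator Q (x, y) = (indicator ?I x * indicator ?J y :: ennreal)" for x y
    by (auto simp: Q_def indicator_def)
  define e where "e = emeasure lborel E"
  define G where "G = (\<integral>\<^sup>+z. ennreal (g z) * indicator Q z \<partial>lborel)"
  define G1 where "G1 y = (\<integral>\<^sup>+t. ennreal (g (t, y)) * indicator ?I t \<partial>lborel)" for y
  define G2 where "G2 x = (\<integral>\<^sup>+t. ennreal (g (x, t)) * indicator ?J t \<partial>lborel)" for x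
  have [measurable]: "G1 \<in> borel_measurable borel" "G2 \<in> borel_measurable borel"
    unfolding G1_def G2_def by measurable
  have G1: "(\<integral>\<^sup>+y. G1 y * indicator ?J y \<partial>lborel) = G"
  proof -
    have "G = (\<integral>\<^sup>+y. \<integral>\<^sup>+x. ennreal (g (x, y)) * indicator Q (x, y) \<partial>lborel \<partial>lborel)"
      unfolding G_def by (rule nn_integral_lborel_pair(2)[symmetric]) measurable
    also have "\<dots> = (\<integral>\<^sup>+y. G1 y * indicator ?J y \<partial>lborel)"
      unfolding G1_def indQ by (simp add: nn_integral_multc[symmetric] mult.assoc)
    finally show ?thesis ..
  qed
  have G2: "(\<integral>\<^sup>+x. G2 x * indicator ?I x \<partial>lborel) = G"
  proof -
    have "G = (\<integral>\<^sup>+x. \<integral>\<^sup>+y. ennreal (g (x, y)) * indicator Q (x, y) \<partial>lborel \<partial>lborel)"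
      unfolding G_def by (rule nn_integral_lborel_pair(1)[symmetric]) measurable
    also have "\<dots> = (\<integral>\<^sup>+x. G2 x * indicator ?I x \<partial>lborel)"
      unfolding G2_def indQ by (subst nn_integral_multc[symmetric]) (simp_all add: ac_simps)
    finally show ?thesis ..
  qed
  have e_fin: "e \<noteq> top"
  proof -
    have "e \<le> emeasure lborel ?I"
      unfolding e_def by (rule emeasure_mono[OF E(2)]) auto
    also have "\<dots> < top" using L by simp
    finally show ?thesis by simp
  qed
  have e_pos: "e \<noteq> 0"
    using E(3) L by (auto simp: e_def)
  have cross: "ennreal \<bar>f (x, y)\<bar> \<le> G1 y + G2 s" if xys: "x \<in> ?I" "y \<in> ?J" "s \<in> E" for x y s
  proof -
    obtain y' where y': "y' \<in> {b..b + L}" "f (s, y') = 0"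
      using zero xys(3) by blast
    have "\<bar>f (x, y)\<bar> \<le> \<bar>f (x, y) - f (s, y)\<bar> + \<bar>f (s, y) - f (s, y')\<bar>"
      using y'(2) by linarith
    then have "ennreal \<bar>f (x, y)\<bar> \<le> ennreal \<bar>f (x, y) - f (s, y)\<bar> + ennreal \<bar>f (s, y) - f (s, y')\<bar>"
      by (simp add: ennreal_leI flip: ennreal_plus)
    also have "\<dots> \<le> G1 y + G2 s"
      unfolding G1_def G2_def using xys E(2) y'
      by (intro add_mono C1_compact_horizontal[OF fg] C1_compact_vertical[OF fg]) auto
    finally show ?thesis .
  qed
  \<comment> \<open>No good column has to be selected: the estimate is integrated over all
    \<open>s\<close> in \<open>E\<close>, and the positive finite measure \<open>e\<close> is
    divided out at the end.\<close>
  have avg: "e * ennreal \<bar>f (x, y)\<bar> \<le> e * G1 y + G" if "x \<in> ?I" "y \<in> ?J" for x y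
  proof -
    have "e * ennreal \<bar>f (x, y)\<bar> = (\<integral>\<^sup>+s. ennreal \<bar>f (x, y)\<bar> * indicator E s \<partial>lborel)"
      by (simp add: e_def nn_integral_cmult_indicator mult.commute[of _ "ennreal \<bar>f (x, y)\<bar>"])
    also have "\<dots> \<le> (\<integral>\<^sup>+s. G1 y * indicator E s + G2 s * indicator ?I s \<partial>lborel)"
      by (rule nn_integral_mono) (use cross[OF that] E(2) in \<open>auto simp: indicator_def\<close>)
    also have "\<dots> = e * G1 y + G"
      by (simp add: nn_integral_add e_def G2 nn_integral_cmult_indicator mult.commute[of _ "G1 y"])
    finally show ?thesis .
  qed
  have "e * (\<integral>\<^sup>+z. ennreal \<bar>f z\<bar> * indicator Q z \<partial>lborel)
      = (\<integral>\<^sup>+z. e * (ennreal \<bar>f z\<bar> * indicator Q z) \<partial>lborel)"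
    by (rule nn_integral_cmult[symmetric]) measurable
  also have "\<dots> = (\<integral>\<^sup>+x. \<integral>\<^sup>+y. e * (ennreal \<bar>f (x, y)\<bar> * indicator Q (x, y)) \<partial>lborel \<partial>lborel)"
    by (rule nn_integral_lborel_pair(1)[symmetric]) measurable
  also have "\<dots> \<le> (\<integral>\<^sup>+x. \<integral>\<^sup>+y. (e * (G1 y * indicator ?J y) + G * indicator ?J y) * indicator ?I x \<partial>lborel \<partial>lborel)"
  proof (intro nn_integral_mono)
    fix x y :: real
    show "e * (ennreal \<bar>f (x, y)\<bar> * indicator Q (x, y))
        \<le> (e * (G1 y * indicator ?J y) + G * indicator ?J y) * indicator ?I x"
      unfolding indQ using avg[of x y] by (auto simp: indicator_def)
  qed
  also have "\<dots> = (e * G + G * ennreal L) * ennreal L"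
    using L by (simp add: nn_integral_multc nn_integral_add nn_integral_cmult G1 nn_integral_cmult_indicator)
  \<comment> \<open>The horizontal segments contribute 1 to the factor \<open>1 + c\<close>; the
    vertical ones contribute \<open>c\<close>, which bounds the ratio of the width of the tile to
    the measure of \<open>E\<close>.\<close>
  also have "\<dots> \<le> (e * G + G * (ennreal c * e)) * ennreal L"
    using E(3) by (intro mult_right_mono add_left_mono mult_left_mono) (auto simp: e_def)
  also have "\<dots> = e * (ennreal ((1 + c) * L) * G)"
    using L by (simp add: ennreal_mult' ennreal_plus algebra_simps del: ennreal_plus)
      (simp add: ennreal_plus[of 1 c] ennreal_mult algebra_simps)
  finally show ?thesis
    using ennreal_mult_le_mult_iff[OF e_pos e_fin] unfolding G_def by blast
qed

section \<open>From one strip to a tile and from tiles to the plane\<close>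

lemma C1_compact_swap:
  assumes "C1_compact f g"
  shows "C1_compact (\<lambda>z. f (prod.swap z)) (\<lambda>z. g (prod.swap z))"
proof -
  obtain f1 f2 where c: "continuous_on UNIV f" "continuous_on UNIV f1" "continuous_on UNIV f2"
      and b: "bounded {z. f z \<noteq> 0}"
      and d: "\<And>x y. ((\<lambda>x. f (x, y)) has_real_derivative f1 (x, y)) (at x)"
        "\<And>x y. ((\<lambda>y. f (x, y)) has_real_derivative f2 (x, y)) (at y)"
      and g: "g = (\<lambda>z. sqrt ((f1 z)\<^sup>2 + (f2 z)\<^sup>2))"
    using assms unfolding C1_compact_def by blast
  have sw: "continuous_on UNIV (\<lambda>z :: real \<times> real. prod.swap z)"
    unfolding prod.swap_def by (intro continuous_intros)
  have "continuous_on UNIV (\<lambda>z. h (prod.swap z))" if "continuous_on UNIV h" for h :: "real \<times> real \<Rightarrow> real"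
    by (rule continuous_on_compose2[OF that sw]) simp
  moreover have "{z. f (prod.swap z) \<noteq> 0} \<subseteq> prod.swap ` {z. f z \<noteq> 0}"
    by force
  then have "bounded {z. f (prod.swap z) \<noteq> 0}"
    using b by (auto simp: bounded_iff norm_Pair) (metis add.commute)
  ultimately show ?thesis
    unfolding C1_compact_def using c d
    by (intro conjI exI[of _ "\<lambda>z. f2 (prod.swap z)"] exI) (auto simp: g add.commute)
qed

lemma nn_integral_lborel_swap:
  fixes F :: "real \<times> real \<Rightarrow> ennreal"
  assumes [measurable]: "F \<in> borel_measurable borel"
  shows "(\<integral>\<^sup>+z. F (prod.swap z) \<partial>lborel) = (\<integral>\<^sup>+z. F z \<partial>lborel)"
proof -
  have [measurable]: "(prod.swap :: real \<times> real \<Rightarrow> real \<times> real) \<in> borel \<rightarrow>\<^sub>M borel"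
    unfolding prod.swap_def by (intro borel_measurable_continuous_onI continuous_intros)
  have "(\<integral>\<^sup>+z. F (prod.swap z) \<partial>lborel) = (\<integral>\<^sup>+x. \<integral>\<^sup>+y. F (prod.swap (x, y)) \<partial>lborel \<partial>lborel)"
    by (rule nn_integral_lborel_pair(1)[symmetric]) measurable
  also have "\<dots> = (\<integral>\<^sup>+z. F z \<partial>lborel)"
    using nn_integral_lborel_pair(2)[OF assms] by simp
  finally show ?thesis .
qed

text \<open>Half-open tiles are disjoint and finitely many of them cover the bounded support of
  \<open>f\<close>, so only finite sums occur. On the right-hand side the tiles left out can only
  help.\<close>

lemma nn_integral_lborel_tiles:
  fixes f g :: "real \<times> real \<Rightarrow> real"
  assumes L: "0 < L" and f: "bounded {z. f z \<noteq> 0}" "f \<in> borel_measurable borel" "g \<in> borel_measurable borel"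
    and tile: "\<And>a b. (\<integral>\<^sup>+z. ennreal \<bar>f z\<bar> * indicator ({a..<a + L} \<times> {b..<b + L}) z \<partial>lborel)
      \<le> C * (\<integral>\<^sup>+z. ennreal (g z) * indicator ({a..<a + L} \<times> {b..<b + L}) z \<partial>lborel)"
  shows "(\<integral>\<^sup>+z. ennreal \<bar>f z\<bar> \<partial>lborel) \<le> C * (\<integral>\<^sup>+z. ennreal (g z) \<partial>lborel)"
proof -
  note f(2,3)[measurable]
  obtain B where B: "\<And>z. f z \<noteq> 0 \<Longrightarrow> norm z \<le> B"
    using f(1) by (auto simp: bounded_iff)
  define P where "P = {- \<lceil>B / L\<rceil> - 1..\<lceil>B / L\<rceil> + 1} \<times> {- \<lceil>B / L\<rceil> - 1..\<lceil>B / L\<rceil> + 1}"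
  define Q where "Q p = {L * of_int (fst p)..<L * of_int (fst p) + L} \<times> {L * of_int (snd p)..<L * of_int (snd p) + L}"
    for p :: "int \<times> int"
  have [measurable]: "Q p \<in> sets borel" for p
    unfolding Q_def by (intro borel_Times) auto
  have fl: "u \<in> {L * of_int i..<L * of_int i + L} \<longleftrightarrow> i = \<lfloor>u / L\<rfloor>" for u and i :: int
    using L by (auto simp: floor_eq_iff eq_commute[of i] field_simps)
  have ind: "indicator (Q p) (x, y) = (if p = (\<lfloor>x / L\<rfloor>, \<lfloor>y / L\<rfloor>) then 1 else 0 :: ennreal)" for p x y
    by (cases p) (auto simp: Q_def fl indicator_def simp del: atLeastLessThan_iff)
  have fin: "finite P" by (simp add: P_def)
  have inP: "(\<lfloor>x / L\<rfloor>, \<lfloor>y / L\<rfloor>) \<in> P" if "f (x, y) \<noteq> 0" for x y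
  proof -
    have "\<bar>x\<bar> \<le> B" "\<bar>y\<bar> \<le> B"
      using B[OF that] norm_fst_le[of x y] norm_snd_le[of y x] by auto
    then have "\<bar>x / L\<bar> \<le> B / L" "\<bar>y / L\<bar> \<le> B / L"
      using L by (auto simp: divide_right_mono abs_divide)
    moreover have "- \<lceil>\<beta>\<rceil> - 1 \<le> \<lfloor>u\<rfloor> \<and> \<lfloor>u\<rfloor> \<le> \<lceil>\<beta>\<rceil> + 1" if "\<bar>u\<bar> \<le> \<beta>" for u \<beta> :: real
      using that le_of_int_ceiling[of \<beta>] by (simp add: le_floor_iff floor_le_iff) linarith
    ultimately show ?thesis
      unfolding P_def by (simp del: abs_divide)
  qed
  have "(\<integral>\<^sup>+z. ennreal \<bar>f z\<bar> \<partial>lborel) \<le> (\<integral>\<^sup>+z. (\<Sum>p\<in>P. ennreal \<bar>f z\<bar> * indicator (Q p) z) \<partial>lborel)"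
  proof (rule nn_integral_mono)
    fix z :: "real \<times> real"
    show "ennreal \<bar>f z\<bar> \<le> (\<Sum>p\<in>P. ennreal \<bar>f z\<bar> * indicator (Q p) z)"
      using inP fin by (cases z; cases "f z = 0") (auto simp: ind if_distrib cong: if_cong)
  qed
  also have "\<dots> = (\<Sum>p\<in>P. \<integral>\<^sup>+z. ennreal \<bar>f z\<bar> * indicator (Q p) z \<partial>lborel)"
    by (rule nn_integral_sum) measurable
  also have "\<dots> \<le> (\<Sum>p\<in>P. C * (\<integral>\<^sup>+z. ennreal (g z) * indicator (Q p) z \<partial>lborel))"
    unfolding Q_def by (intro sum_mono tile)
  also have "\<dots> = C * (\<integral>\<^sup>+z. (\<Sum>p\<in>P. ennreal (g z) * indicator (Q p) z) \<partial>lborel)"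
    by (simp add: nn_integral_sum sum_distrib_left)
  also have "\<dots> \<le> C * (\<integral>\<^sup>+z. ennreal (g z) \<partial>lborel)"
  proof (intro mult_left_mono nn_integral_mono)
    fix z :: "real \<times> real"
    show "(\<Sum>p\<in>P. ennreal (g z) * indicator (Q p) z) \<le> ennreal (g z)"
      using fin by (cases z) (auto simp: ind if_distrib cong: if_cong)
  qed simp
  finally show ?thesis .
qed

context perforated_plane
begin

text \<open>One of the two projections has at least half of the total length \<open>L / 16\<close>.
  Hence the strip estimate applies with \<open>c = 32\<close>, after swapping the coordinates if it
  is the projection to the second axis, and \<open>33 = 1 + 32\<close>.\<close>

lemma tile_poincare:
  fixes a b :: real and n :: nat
  assumes n: "2 * k \<le> n * n" "0 < n" and fg: "C1_compact f g" and f0: "\<And>z. z \<notin> \<Omega> \<Longrightarrow> f z = 0"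
  defines "L \<equiv> 4 * d * real n"
  defines "Q \<equiv> {a..<a + L} \<times> {b..<b + L}"
  shows "(\<integral>\<^sup>+z. ennreal \<bar>f z\<bar> * indicator Q z \<partial>lborel)
    \<le> ennreal (33 * L) * (\<integral>\<^sup>+z. ennreal (g z) * indicator Q z \<partial>lborel)"
proof -
  have L: "0 < L" using n d_pos by (simp add: L_def)
  define K where "K = cbox (a, b) (a + L, b + L) - \<Omega>"
  define E where "E = fst ` K \<inter> {a..<a + L}"
  define F where "F = snd ` K \<inter> {b..<b + L}"
  have "compact K"
    unfolding K_def by (intro compact_diff compact_cbox open_\<Omega>)
  then have "compact (fst ` K)" "compact (snd ` K)"
    by (auto intro!: compact_continuous_image continuous_intros)
  then have EF: "E \<in> sets borel" "F \<in> sets borel"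
    by (auto simp: E_def F_def borel_compact)
  have em: "ennreal L \<le> ennreal 32 * emeasure lborel S"
    if "S \<in> sets borel" "S \<subseteq> {c..<c + L}" "L / 32 \<le> measure lebesgue S" for S c
  proof -
    have "emeasure lborel S \<le> emeasure lborel {c..<c + L}"
      by (rule emeasure_mono[OF that(2)]) auto
    also have "\<dots> < top" using L by simp
    finally have "emeasure lborel S = ennreal (measure lborel S)"
      by (simp add: emeasure_eq_ennreal_measure)
    moreover have "L \<le> 32 * measure lborel S"
      using that by simp
    ultimately show ?thesis
      by (simp add: ennreal_leI flip: ennreal_mult ennreal_numeral)
  qed
  have K: "x \<in> fst ` K \<Longrightarrow> \<exists>y\<in>{b..b + L}. f (x, y) = 0" "y \<in> snd ` K \<Longrightarrow> \<exists>x\<in>{a..a + L}. f (x, y) = 0"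
    for x y
    using f0 by (force simp: K_def cbox_Pair_iff)+
  have "L / 16 \<le> measure lebesgue E + measure lebesgue F"
    using tile_projections[OF n(1), of a b] by (simp add: E_def F_def K_def L_def)
  then consider "L / 32 \<le> measure lebesgue E" | "L / 32 \<le> measure lebesgue F"
    by linarith
  then show ?thesis
  proof cases
    case 1
    show ?thesis
      using strip_poincare[OF fg L(1) _ EF(1) _ em[OF EF(1) _ 1], of a a b] K(1)
      by (auto simp: E_def Q_def)
  next
    case 2
    have [measurable]: "f \<in> borel_measurable borel" "g \<in> borel_measurable borel"
      by (rule borel_measurable_continuous_onI[OF C1_compact_continuous[OF fg]]
        borel_measurable_continuous_onI[OF C1_compact_continuous_grad[OF fg]])+
    have Qm[measurable]: "Q \<in> sets borel"
      unfolding Q_def by (intro borel_Times) auto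
    have sw: "indicator ({b..<b + L} \<times> {a..<a + L}) z = (indicator Q (prod.swap z) :: ennreal)" for z
      by (cases z) (auto simp: Q_def indicator_def)
    have "(\<integral>\<^sup>+z. ennreal \<bar>f (prod.swap z)\<bar> * indicator Q (prod.swap z) \<partial>lborel)
      \<le> ennreal (33 * L) * (\<integral>\<^sup>+z. ennreal (g (prod.swap z)) * indicator Q (prod.swap z) \<partial>lborel)"
      using strip_poincare[OF C1_compact_swap[OF fg] L(1) _ EF(2) _ em[OF EF(2) _ 2], of b b a] K(2)
      by (auto simp: F_def sw)
    then show ?thesis
      using nn_integral_lborel_swap[of "\<lambda>z. ennreal \<bar>f z\<bar> * indicator Q z"]
        nn_integral_lborel_swap[of "\<lambda>z. ennreal (g z) * indicator Q z"] by simp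
  qed
qed

text \<open>The least \<open>n\<close> with \<open>2 * k \<le> n * n\<close> is at most
  \<open>sqrt (2 * k) + 1\<close>, hence at most \<open>3 * sqrt k\<close>. The tile has side
  \<open>4 * d * n\<close>, and \<open>396 = 33 * 4 * 3\<close>.\<close>

theorem poincare:
  assumes k: "1 \<le> k" and fg: "C1_compact f g" and f0: "\<And>z. z \<notin> \<Omega> \<Longrightarrow> f z = 0"
  shows "(\<integral>\<^sup>+z. ennreal \<bar>f z\<bar> \<partial>lborel) \<le> ennreal (396 * sqrt k * d) * (\<integral>\<^sup>+z. ennreal (g z) \<partial>lborel)"
proof -
  define n where "n = nat \<lceil>sqrt (2 * real k)\<rceil>"
  have n: "sqrt (2 * real k) \<le> n" "n \<le> sqrt (2 * real k) + 1"
    by (auto simp: n_def of_nat_nat ceiling_le_iff real_nat_ceiling_ge)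
  have "sqrt (2 * real k) \<le> 2 * sqrt k" "1 \<le> sqrt k"
    using k by (auto intro!: real_le_lsqrt simp: power_mult_distrib)
  then have n3: "n \<le> 3 * sqrt k" using n by linarith
  have "2 * real k = (sqrt (2 * real k))\<^sup>2"
    by simp
  also have "\<dots> \<le> (real n)\<^sup>2"
    by (rule power_mono[OF n(1)]) simp
  finally have "real (2 * k) \<le> real (n * n)"
    by (simp add: power2_eq_square)
  then have kn: "2 * k \<le> n * n"
    by (simp only: of_nat_le_iff)
  then have n0: "0 < n" using k by (cases "n = 0") auto
  have "(\<integral>\<^sup>+z. ennreal \<bar>f z\<bar> \<partial>lborel) \<le> ennreal (33 * (4 * d * real n)) * (\<integral>\<^sup>+z. ennreal (g z) \<partial>lborel)"
    by (rule nn_integral_lborel_tiles[of "4 * d * real n"])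
      (use d_pos n0 C1_compact_bounded[OF fg] tile_poincare[OF kn n0 fg f0]
        borel_measurable_continuous_onI[OF C1_compact_continuous[OF fg]]
        borel_measurable_continuous_onI[OF C1_compact_continuous_grad[OF fg]] in auto)
  also have "\<dots> \<le> ennreal (396 * sqrt k * d) * (\<integral>\<^sup>+z. ennreal (g z) \<partial>lborel)"
  proof (intro mult_right_mono ennreal_leI)
    have "132 * d * real n \<le> 132 * d * (3 * sqrt k)"
      using n3 d_pos by (intro mult_left_mono) auto
    then show "33 * (4 * d * real n) \<le> 396 * sqrt k * d"
      by (simp add: algebra_simps)
  qed simp
  finally show ?thesis .
qed

end

section \<open>Interpolation between the two inequalities\<close>

text \<open>Exponents that sum to 1 fit the applications, where \<open>X\<close> and
  \<open>Y\<close> are themselves powers. After both integrals are normalised to 1, the claim is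
  Young's inequality integrated.\<close>

lemma holder_inequality:
  fixes X Y :: "'a \<Rightarrow> real"
  assumes X: "integrable M X" "\<And>x. 0 \<le> X x" and Y: "integrable M Y" "\<And>x. 0 \<le> Y x"
    and \<alpha>: "0 < \<alpha>" "\<alpha> < 1"
  shows "(\<integral>x. X x powr \<alpha> * Y x powr (1 - \<alpha>) \<partial>M)
      \<le> (\<integral>x. X x \<partial>M) powr \<alpha> * (\<integral>x. Y x \<partial>M) powr (1 - \<alpha>)"
proof -
  have [measurable]: "X \<in> borel_measurable M" "Y \<in> borel_measurable M"
    using X Y by auto
  have young: "a powr \<alpha> * b powr (1 - \<alpha>) \<le> \<alpha> * a + (1 - \<alpha>) * b" if "0 \<le> a" "0 \<le> b" for a b :: real
    using Youngs_inequality_0[of \<alpha> "1 - \<alpha>" a b] that \<alpha>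
    by (cases "a = 0 \<or> b = 0") auto
  have int: "integrable M (\<lambda>x. X x powr \<alpha> * Y x powr (1 - \<alpha>))"
    by (rule Bochner_Integration.integrable_bound[of M "\<lambda>x. \<alpha> * X x + (1 - \<alpha>) * Y x"])
      (use X Y \<alpha> young in \<open>auto simp: abs_mult\<close>)
  define A where "A = (\<integral>x. X x \<partial>M)"
  define B where "B = (\<integral>x. Y x \<partial>M)"
  have AB: "0 \<le> A" "0 \<le> B"
    using X Y by (auto simp: A_def B_def)
  show "(\<integral>x. X x powr \<alpha> * Y x powr (1 - \<alpha>) \<partial>M) \<le> A powr \<alpha> * B powr (1 - \<alpha>)"
  proof (cases "A = 0 \<or> B = 0")
    case True
    \<comment> \<open>An integral that vanishes cannot be normalised, but then the product vanishes
      almost everywhere.\<close>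
    then have "(AE x in M. X x = 0) \<or> (AE x in M. Y x = 0)"
      using X Y by (auto simp: A_def B_def integral_nonneg_eq_0_iff_AE)
    then have "AE x in M. X x powr \<alpha> * Y x powr (1 - \<alpha>) = 0"
      by (auto elim: eventually_mono)
    then have "(\<integral>x. X x powr \<alpha> * Y x powr (1 - \<alpha>) \<partial>M) = 0"
      by (rule integral_eq_zero_AE)
    then show ?thesis by simp
  next
    case False
    then have pos: "0 < A" "0 < B" using AB by auto
    have "(\<integral>x. X x powr \<alpha> * Y x powr (1 - \<alpha>) \<partial>M) / (A powr \<alpha> * B powr (1 - \<alpha>))
        = (\<integral>x. (X x / A) powr \<alpha> * (Y x / B) powr (1 - \<alpha>) \<partial>M)"
      using X Y pos by (simp add: powr_divide)
    also have "\<dots> \<le> (\<integral>x. \<alpha> * (X x / A) + (1 - \<alpha>) * (Y x / B) \<partial>M)"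
    proof (rule integral_mono)
      show "integrable M (\<lambda>x. (X x / A) powr \<alpha> * (Y x / B) powr (1 - \<alpha>))"
        using int X Y pos by (simp add: powr_divide)
      show "(X x / A) powr \<alpha> * (Y x / B) powr (1 - \<alpha>) \<le> \<alpha> * (X x / A) + (1 - \<alpha>) * (Y x / B)" for x
        using X Y pos by (intro young) auto
    qed (use X Y in auto)
    also have "\<dots> = \<alpha> * (A / A) + (1 - \<alpha>) * (B / B)"
      using X Y unfolding A_def B_def by (subst Bochner_Integration.integral_add) auto
    also have "\<dots> = 1" using pos by simp
    finally show ?thesis using pos by (simp add: divide_le_eq)
  qed
qed

section \<open>Powers of compactly supported functions\<close>

lemma integrable_continuous_bounded_support:
  fixes h :: "'a::euclidean_space \<Rightarrow> real"
  assumes "continuous_on UNIV h" "bounded {z. h z \<noteq> 0}"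
  shows "integrable lborel h"
proof -
  have "integrable lborel (\<lambda>x. indicator (closure {z. h z \<noteq> 0}) x *\<^sub>R h x)"
    using assms by (intro borel_integrable_compact) (auto intro: continuous_on_subset)
  also have "(\<lambda>x. indicator (closure {z. h z \<noteq> 0}) x *\<^sub>R h x) = h"
    using closure_subset[of "{z. h z \<noteq> 0}"] by (auto simp: indicator_def fun_eq_iff)
  finally show ?thesis .
qed

lemma integrable_powr_bounded_support:
  fixes h :: "'a::euclidean_space \<Rightarrow> real"
  assumes "continuous_on UNIV h" "bounded {z. h z \<noteq> 0}" "0 < r"
  shows "integrable lborel (\<lambda>z. \<bar>h z\<bar> powr r)"
proof (rule integrable_continuous_bounded_support)
  show "continuous_on UNIV (\<lambda>z. \<bar>h z\<bar> powr r)"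
    using assms(3) by (intro continuous_on_powr' continuous_on_rabs assms(1) continuous_on_const) auto
  show "bounded {z. \<bar>h z\<bar> powr r \<noteq> 0}"
    by (rule bounded_subset[OF assms(2)]) auto
qed

text \<open>The one-sided power is continuously differentiable across 0 because \<gamma> exceeds 1.
  It is the building block both of \<open>|s|^\<gamma>\<close> and of the quadratic profile used for
  truncation.\<close>

lemma has_real_derivative_max_powr:
  fixes \<gamma> :: real
  assumes "1 < \<gamma>"
  shows "((\<lambda>s. max 0 s powr \<gamma>) has_real_derivative \<gamma> * max 0 s powr (\<gamma> - 1)) (at s)"
proof -
  consider "s < 0" | "s = 0" | "0 < s" by linarith
  then show ?thesis
  proof cases
    case 1
    have "((\<lambda>s. max 0 s powr \<gamma>) has_real_derivative 0) (at s)"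
      by (rule has_field_derivative_transform_within_open[OF DERIV_const[of 0], where S = "{..<0}"])
        (use 1 in auto)
    with 1 show ?thesis by simp
  next
    case 2
    have "((\<lambda>h. max 0 h powr \<gamma> / h) \<longlongrightarrow> 0) (at 0)"
    proof (rule Lim_null_comparison)
      have "norm (max 0 h powr \<gamma> / h) \<le> \<bar>h\<bar> powr (\<gamma> - 1)" for h
      proof (cases "0 < h")
        case True
        then show ?thesis by (simp add: powr_diff)
      next
        case False
        then show ?thesis by (simp add: max.absorb1)
      qed
      then show "\<forall>\<^sub>F h in at 0. norm (max 0 h powr \<gamma> / h) \<le> \<bar>h\<bar> powr (\<gamma> - 1)"
        by simp
      have "isCont (\<lambda>h. \<bar>h\<bar> powr (\<gamma> - 1)) 0"
        using assms continuous_on_powr'[of UNIV "\<lambda>h::real. \<bar>h\<bar>" "\<lambda>_. \<gamma> - 1"]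
        by (auto simp: continuous_on_eq_continuous_at intro!: continuous_intros)
      then show "((\<lambda>h. \<bar>h\<bar> powr (\<gamma> - 1)) \<longlongrightarrow> 0) (at 0)"
        by (simp add: isCont_def)
    qed
    with 2 show ?thesis by (simp add: DERIV_def)
  next
    case 3
    have "((\<lambda>s. s powr \<gamma>) has_real_derivative \<gamma> * s powr (\<gamma> - 1)) (at s)"
      using 3 by (rule has_real_derivative_powr)
    then have "((\<lambda>s. max 0 s powr \<gamma>) has_real_derivative \<gamma> * s powr (\<gamma> - 1)) (at s)"
      by (rule has_field_derivative_transform_within_open[where S = "{0<..}"]) (use 3 in auto)
    with 3 show ?thesis by simp
  qed
qed

lemma C1_compact_powr:
  assumes fg: "C1_compact f g" and \<gamma>: "1 < \<gamma>"
  shows "C1_compact (\<lambda>z. \<bar>f z\<bar> powr \<gamma>) (\<lambda>z. \<gamma> * \<bar>f z\<bar> powr (\<gamma> - 1) * g z)"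
proof -
  \<comment> \<open>\<open>|s| powr \<gamma>\<close> as a sum of two one-sided powers, which are
    differentiable at 0 as well.\<close>
  let ?\<psi> = "\<lambda>s. max 0 s powr \<gamma> + max 0 (- s) powr \<gamma>"
  let ?\<psi>' = "\<lambda>s. \<gamma> * max 0 s powr (\<gamma> - 1) + \<gamma> * max 0 (- s) powr (\<gamma> - 1) * (- 1)"
  have "(?\<psi> has_real_derivative ?\<psi>' s) (at s)" for s
    by (intro DERIV_add has_real_derivative_max_powr[OF \<gamma>]
        DERIV_chain2[OF has_real_derivative_max_powr[OF \<gamma>]] DERIV_minus[OF DERIV_ident])
  moreover have "continuous_on UNIV ?\<psi>'"
    using \<gamma> by (auto intro!: continuous_intros continuous_on_powr')
  ultimately have "C1_compact (\<lambda>z. ?\<psi> (f z)) (\<lambda>z. \<bar>?\<psi>' (f z)\<bar> * g z)"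
    using \<gamma> by (intro C1_compact_compose[OF fg]) auto
  moreover have "?\<psi> s = \<bar>s\<bar> powr \<gamma>" "\<bar>?\<psi>' s\<bar> = \<gamma> * \<bar>s\<bar> powr (\<gamma> - 1)" for s
    using \<gamma> by (cases "0 \<le> s"; simp add: max_def abs_mult)+
  ultimately show ?thesis by simp
qed

lemma sobolev_L1:
  assumes "C1_compact f g"
  shows "(\<integral>z. (f z)\<^sup>2 \<partial>lborel) \<le> (\<integral>z. g z \<partial>lborel)\<^sup>2"
proof -
  have "integrable lborel g"
    by (intro integrable_continuous_bounded_support C1_compact_continuous_grad[OF assms] C1_compact_bounded_grad[OF assms])
  moreover have "integrable lborel (\<lambda>z. (f z)\<^sup>2)"
    using C1_compact_continuous[OF assms] C1_compact_bounded[OF assms]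
    by (intro integrable_continuous_bounded_support) (auto intro!: continuous_intros)
  ultimately show ?thesis
    using gagliardo_nirenberg[OF assms] C1_compact_nonneg[OF assms]
    by (simp add: nn_integral_eq_integral ennreal_power)
qed

text \<open>From here on the domain enters only through its Poincare constant \<open>a\<close> for
  the exponent 1; \<open>sobolev_L1\<close> holds on the whole plane.\<close>

locale poincare_domain =
  fixes \<Omega> :: "(real \<times> real) set" and a :: real
  assumes a_pos: "0 < a"
    and poincare_nn: "C1_compact f g \<Longrightarrow> (\<And>z. z \<notin> \<Omega> \<Longrightarrow> f z = 0) \<Longrightarrow>
      (\<integral>\<^sup>+z. ennreal \<bar>f z\<bar> \<partial>lborel) \<le> ennreal a * (\<integral>\<^sup>+z. ennreal (g z) \<partial>lborel)"
begin

lemma poincare_L1: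
  assumes fg: "C1_compact f g" and f0: "\<And>z. z \<notin> \<Omega> \<Longrightarrow> f z = 0"
  shows "(\<integral>z. \<bar>f z\<bar> \<partial>lborel) \<le> a * (\<integral>z. g z \<partial>lborel)"
proof -
  have "integrable lborel g"
    by (intro integrable_continuous_bounded_support C1_compact_continuous_grad[OF fg] C1_compact_bounded_grad[OF fg])
  moreover have "integrable lborel (\<lambda>z. \<bar>f z\<bar>)"
    using C1_compact_continuous[OF fg] C1_compact_bounded[OF fg]
    by (intro integrable_continuous_bounded_support) (auto intro!: continuous_intros)
  ultimately show ?thesis
    using poincare_nn[OF fg f0] C1_compact_nonneg[OF fg] a_pos
    by (simp add: nn_integral_eq_integral flip: ennreal_mult)
qed

text \<open>Hoelder with weight \<open>2 - s\<close> on the integral of \<open>|f|\<close> and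
  \<open>s - 1\<close> on that of its square, since \<open>(2 - s) + 2 * (s - 1) = s\<close>. The
  endpoints are separate because \<open>holder_inequality\<close> wants weights strictly between 0
  and 1.\<close>

lemma interpolate_L1_L2:
  assumes fg: "C1_compact f g" and f0: "\<And>z. z \<notin> \<Omega> \<Longrightarrow> f z = 0" and s: "1 \<le> s" "s \<le> 2"
  shows "(\<integral>z. \<bar>f z\<bar> powr s \<partial>lborel) \<le> a powr (2 - s) * (\<integral>z. g z \<partial>lborel) powr s"
proof -
  define W where "W = (\<integral>z. g z \<partial>lborel)"
  have W: "0 \<le> W"
    unfolding W_def using C1_compact_nonneg[OF fg] by simp
  have P: "(\<integral>z. \<bar>f z\<bar> \<partial>lborel) \<le> a * W" and S: "(\<integral>z. (f z)\<^sup>2 \<partial>lborel) \<le> W\<^sup>2"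
    using poincare_L1[OF fg f0] sobolev_L1[OF fg] by (simp_all add: W_def)
  consider "s = 1" | "s = 2" | "1 < s" "s < 2" using s by linarith
  then have "(\<integral>z. \<bar>f z\<bar> powr s \<partial>lborel) \<le> a powr (2 - s) * W powr s"
  proof cases
    case 1
    then show ?thesis using P W a_pos by simp
  next
    case 2
    then show ?thesis using S W a_pos by (simp add: powr_numeral)
  next
    case 3
    have e: "\<bar>x\<bar> powr (2 - s) * (x\<^sup>2) powr (s - 1) = \<bar>x\<bar> powr s" for x :: real
    proof (cases "x = 0")
      case False
      have "x\<^sup>2 = \<bar>x\<bar> powr 2"
        using False by simp
      then have "(x\<^sup>2) powr (s - 1) = \<bar>x\<bar> powr (2 * (s - 1))"
        by (simp only: powr_powr)
      then show ?thesis
        using False by (simp flip: powr_add)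
    qed simp
    have "integrable lborel (\<lambda>z. \<bar>f z\<bar>)" "integrable lborel (\<lambda>z. (f z)\<^sup>2)"
      using C1_compact_continuous[OF fg] C1_compact_bounded[OF fg]
      by (intro integrable_continuous_bounded_support; auto intro!: continuous_intros)+
    then have "(\<integral>z. \<bar>f z\<bar> powr s \<partial>lborel)
        \<le> (\<integral>z. \<bar>f z\<bar> \<partial>lborel) powr (2 - s) * (\<integral>z. (f z)\<^sup>2 \<partial>lborel) powr (1 - (2 - s))"
      using holder_inequality[of lborel "\<lambda>z. \<bar>f z\<bar>" "\<lambda>z. (f z)\<^sup>2" "2 - s"] 3 by (simp add: e)
    also have "\<dots> \<le> (a * W) powr (2 - s) * (W\<^sup>2) powr (1 - (2 - s))"
      using P S 3 by (intro mult_mono powr_mono2) auto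
    also have "\<dots> = a powr (2 - s) * W powr s"
      using e[of W] W a_pos by (simp add: powr_mult mult.assoc)
    finally show ?thesis .
  qed
  then show ?thesis
    by (simp add: W_def)
qed

text \<open>The interpolated inequality is applied to \<open>|f| powr \<gamma>\<close> with
  \<open>s = q / \<gamma>\<close>. As \<open>(\<gamma> - 1) * p / (p - 1) = q\<close>, Hoelder's
  inequality bounds the integral of its gradient by a power of \<open>N\<close> below the first,
  times the gradient norm of \<open>f\<close>. The two hypotheses on \<open>q\<close> say exactly
  that \<open>s\<close> lies between 1 and 2; equality in the second is the critical
  exponent.\<close>

theorem poincare_sobolev:
  assumes fg: "C1_compact f g" and f0: "\<And>z. z \<notin> \<Omega> \<Longrightarrow> f z = 0"
    and p: "1 \<le> p" and q: "p \<le> q" "0 \<le> 1 - 2 / p + 2 / q"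
  shows "(\<integral>z. \<bar>f z\<bar> powr q \<partial>lborel) powr (1 / q)
    \<le> (1 + q * (1 - 1 / p)) * a powr (1 - 2 / p + 2 / q) * (\<integral>z. g z powr p \<partial>lborel) powr (1 / p)"
proof -
  define \<gamma> where "\<gamma> = 1 + q * (1 - 1 / p)"
  define s where "s = q / \<gamma>"
  define N where "N = (\<integral>z. \<bar>f z\<bar> powr q \<partial>lborel)"
  define G where "G = (\<integral>z. g z powr p \<partial>lborel)"
  have g0: "0 \<le> g z" for z by (rule C1_compact_nonneg[OF fg])
  have NG: "0 \<le> N" "0 \<le> G" by (auto simp: N_def G_def)
  have \<gamma>1: "1 \<le> \<gamma>" using p q by (auto simp: \<gamma>_def)
  have "\<gamma> \<le> q" "q \<le> 2 * \<gamma>"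
    using p q by (auto simp: \<gamma>_def field_simps)
  then have s: "1 \<le> s" "s \<le> 2" using \<gamma>1 by (auto simp: s_def field_simps)
  have q0: "0 < q" using p q by simp
  have exps: "(2 - s) / s = 1 - 2 / p + 2 / q"
  proof -
    have "(2 - s) / s = 2 * \<gamma> / q - 1"
      using \<gamma>1 q0 by (simp add: s_def field_simps)
    then show ?thesis
      using q0 p by (simp add: \<gamma>_def field_simps)
  qed
  have key: "N \<le> a powr (2 - s) * (\<gamma> * N powr (1 - 1 / p) * G powr (1 / p)) powr s"
  proof (cases "p = 1")
    case True
    then have "\<gamma> = 1" "s = q" by (auto simp: \<gamma>_def s_def)
    show ?thesis
    \<comment> \<open>For \<open>p = 1\<close> the exponent of \<open>N\<close> is 0, and
      \<open>N powr 0\<close> is 0 rather than 1 when \<open>N = 0\<close>.\<close>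
    proof (cases "N = 0")
      case False
      then show ?thesis
        using interpolate_L1_L2[OF fg f0 s] True \<open>\<gamma> = 1\<close> \<open>s = q\<close> g0 NG
        by (simp add: N_def G_def)
    qed (use True in simp)
  next
    case False
    then have p1: "1 < p" using p by simp
    then have \<gamma>: "1 < \<gamma>" using q0 by (simp add: \<gamma>_def)
    have "N = (\<integral>z. \<bar>\<bar>f z\<bar> powr \<gamma>\<bar> powr s \<partial>lborel)"
      using \<gamma> by (simp add: N_def powr_powr s_def)
    also have "\<dots> \<le> a powr (2 - s) * (\<integral>z. \<gamma> * \<bar>f z\<bar> powr (\<gamma> - 1) * g z \<partial>lborel) powr s" (is "_ \<le> _ * ?W powr s")
      by (rule interpolate_L1_L2[OF C1_compact_powr[OF fg \<gamma>] _ s]) (simp add: f0)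
    also have "\<dots> \<le> a powr (2 - s) * (\<gamma> * N powr (1 - 1 / p) * G powr (1 / p)) powr s"
    proof (intro mult_left_mono powr_mono2)
      show "0 \<le> ?W" using \<gamma> g0 by (intro integral_nonneg_AE) auto
      show "?W \<le> \<gamma> * N powr (1 - 1 / p) * G powr (1 / p)"
      proof -
        have "integrable lborel (\<lambda>z. \<bar>f z\<bar> powr q)" "integrable lborel (\<lambda>z. \<bar>g z\<bar> powr p)"
          using p q0 by (intro integrable_powr_bounded_support C1_compact_continuous[OF fg] C1_compact_bounded[OF fg]
            C1_compact_continuous_grad[OF fg] C1_compact_bounded_grad[OF fg]; simp)+
        then have "(\<integral>z. (\<bar>f z\<bar> powr q) powr (1 - 1 / p) * (g z powr p) powr (1 - (1 - 1 / p)) \<partial>lborel)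
            \<le> N powr (1 - 1 / p) * G powr (1 - (1 - 1 / p))"
          unfolding N_def G_def using p1 g0 by (intro holder_inequality) auto
        moreover have "(\<bar>f z\<bar> powr q) powr (1 - 1 / p) * (g z powr p) powr (1 - (1 - 1 / p))
            = \<bar>f z\<bar> powr (\<gamma> - 1) * g z" for z
          using p1 g0[of z] by (simp add: powr_powr \<gamma>_def)
        ultimately have "(\<integral>z. \<bar>f z\<bar> powr (\<gamma> - 1) * g z \<partial>lborel) \<le> N powr (1 - 1 / p) * G powr (1 / p)"
          by simp
        then show ?thesis
          using \<gamma> by (simp add: mult.assoc)
      qed
    qed (use s in auto)
    finally show ?thesis .
  qed
  show ?thesis
    unfolding N_def[symmetric] G_def[symmetric] \<gamma>_def[symmetric]
  proof (cases "N = 0")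
    case False
    then have N: "0 < N" using NG by simp
    have "q * (1 - 1 / p) = \<gamma> - 1"
      by (simp add: \<gamma>_def)
    \<comment> \<open>So \<open>N\<close> occurs on the right with power
      \<open>1 - 1 / \<gamma>\<close>. Cancelling it leaves \<open>N powr (1 / \<gamma>)\<close>,
      whose power \<open>1 / s\<close> is \<open>N powr (1 / q)\<close> since
      \<open>\<gamma> * s = q\<close>.\<close>
    then have e: "s * (1 - 1 / p) = 1 - 1 / \<gamma>"
      using \<gamma>1 by (simp add: s_def diff_divide_distrib)
    have "N powr (1 - 1 / \<gamma>) * N powr (1 / \<gamma>) = N"
      using N by (simp flip: powr_add)
    also have "N \<le> N powr (1 - 1 / \<gamma>) * (a powr (2 - s) * (\<gamma> * G powr (1 / p)) powr s)"
      using key NG \<gamma>1 N by (simp add: powr_mult powr_powr e[symmetric] mult_ac)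
    finally have "N powr (1 / \<gamma>) \<le> a powr (2 - s) * (\<gamma> * G powr (1 / p)) powr s"
      using N by simp
    then have "(N powr (1 / \<gamma>)) powr (1 / s) \<le> (a powr (2 - s) * (\<gamma> * G powr (1 / p)) powr s) powr (1 / s)"
      using s by (intro powr_mono2) auto
    also have "\<dots> = a powr ((2 - s) / s) * (\<gamma> * G powr (1 / p))"
      using s \<gamma>1 NG by (simp add: powr_mult powr_powr)
    also have "(N powr (1 / \<gamma>)) powr (1 / s) = N powr (1 / q)"
      using \<gamma>1 q0 by (simp add: powr_powr s_def)
    finally show "N powr (1 / q) \<le> \<gamma> * a powr (1 - 2 / p + 2 / q) * G powr (1 / p)"
      unfolding exps by (simp add: mult_ac)
  qed (use \<gamma>1 in auto)
qed

end

section \<open>Truncation and superlevel sets\<close>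

text \<open>A smoothed form of the cut-off that rises linearly from 0 to 1 while \<open>|f|\<close>
  runs from \<open>t\<close> to \<open>t + h\<close>: the piecewise linear one has no continuous
  derivative. The price is the factor 2 in the slope.\<close>

lemma C1_compact_truncate:
  assumes fg: "C1_compact f g" and t: "0 \<le> t" and h: "0 < h"
  obtains v w where "C1_compact v w" "\<And>z. t + h \<le> \<bar>f z\<bar> \<Longrightarrow> v z = 1"
    "\<And>z. w z \<le> 2 / h * (g z * indicator {z. t \<le> \<bar>f z\<bar> \<and> \<bar>f z\<bar> < t + h} z)"
proof -
  \<comment> \<open>\<open>\<sigma>\<close> rises from 0 to 1 on the unit interval, its derivative being a tent of height 2\<close>
  define \<sigma> where "\<sigma> r = 2 * max 0 r powr 2 - 4 * max 0 (r - 1 / 2) powr 2 + 2 * max 0 (r - 1) powr 2" for r :: real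
  define \<sigma>' where "\<sigma>' r = 4 * max 0 r - 8 * max 0 (r - 1 / 2) + 4 * max 0 (r - 1)" for r :: real
  have d2: "((\<lambda>r. max 0 (r - c) powr 2) has_real_derivative 2 * max 0 (r - c)) (at r)" for r c :: real
    using DERIV_chain2[OF has_real_derivative_max_powr[of 2 "r - c"] DERIV_diff[OF DERIV_ident DERIV_const]]
    by (simp add: powr_one)
  have d\<sigma>: "(\<sigma> has_real_derivative \<sigma>' r) (at r)" for r
    using DERIV_add[OF DERIV_diff[OF DERIV_cmult[OF d2[of 0 r], of 2] DERIV_cmult[OF d2[of "1 / 2" r], of 4]]
        DERIV_cmult[OF d2[of 1 r], of 2]]
    unfolding \<sigma>_def[abs_def] \<sigma>'_def by simp
  have \<sigma>_0: "\<sigma> r = 0" "\<sigma>' r = 0" if "r \<le> 0" for r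
    using that by (auto simp: \<sigma>_def \<sigma>'_def max_def)
  have \<sigma>_1: "\<sigma> r = 1" "\<sigma>' r = 0" if "1 \<le> r" for r
    using that by (auto simp: \<sigma>_def \<sigma>'_def max_def power2_eq_square algebra_simps)
  have \<sigma>_2: "\<bar>\<sigma>' r\<bar> \<le> 2" for r
    by (auto simp: \<sigma>'_def max_def)
  \<comment> \<open>One copy of \<sigma> for each sign of \<open>f\<close>. As \<open>t\<close> is
    nonnegative, at most one of them has a nonzero derivative at a given \<open>s\<close>.\<close>
  let ?\<psi> = "\<lambda>s. \<sigma> ((s - t) / h) + \<sigma> ((- s - t) / h)"
  let ?\<psi>' = "\<lambda>s. \<sigma>' ((s - t) / h) * (1 / h) + \<sigma>' ((- s - t) / h) * (- 1 / h)"
  have "((\<lambda>s. (s - t) / h) has_real_derivative 1 / h) (at s)"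
    "((\<lambda>s. (- s - t) / h) has_real_derivative - 1 / h) (at s)" for s
    using h by (auto intro!: derivative_eq_intros)
  then have "(?\<psi> has_real_derivative ?\<psi>' s) (at s)" for s
    by (intro DERIV_add DERIV_chain2[OF d\<sigma>])
  moreover have c\<sigma>': "continuous_on UNIV \<sigma>'"
    unfolding \<sigma>'_def[abs_def] by (intro continuous_intros)
  have "continuous_on UNIV (\<lambda>s. \<sigma>' ((s - t) / h))" "continuous_on UNIV (\<lambda>s. \<sigma>' ((- s - t) / h))"
    by (rule continuous_on_compose2[OF c\<sigma>']; use h in \<open>auto intro!: continuous_intros\<close>)+
  then have "continuous_on UNIV ?\<psi>'"
    by (intro continuous_on_add continuous_on_mult continuous_on_const)
  moreover have "?\<psi> 0 = 0"
    using \<sigma>_0 t h by simp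
  ultimately have C: "C1_compact (\<lambda>z. ?\<psi> (f z)) (\<lambda>z. \<bar>?\<psi>' (f z)\<bar> * g z)"
    by (intro C1_compact_compose[OF fg])
  have V: "?\<psi> s = 1" if "t + h \<le> \<bar>s\<bar>" for s
  proof (cases "0 \<le> s")
    case True
    then have "1 \<le> (s - t) / h" "(- s - t) / h \<le> 0"
      using that t h by (auto simp: field_simps)
    then show ?thesis using \<sigma>_0 \<sigma>_1 by simp
  next
    case False
    then have "(s - t) / h \<le> 0" "1 \<le> (- s - t) / h"
      using that t h by (auto simp: field_simps)
    then show ?thesis using \<sigma>_0 \<sigma>_1 by simp
  qed
  have W: "\<bar>?\<psi>' s\<bar> \<le> 2 / h * (if t \<le> \<bar>s\<bar> \<and> \<bar>s\<bar> < t + h then 1 else 0)" for s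
  proof -
    have one: "\<bar>\<sigma>' ((u - t) / h)\<bar> \<le> 2 * (if t \<le> u \<and> u < t + h then 1 else 0)" for u
      using \<sigma>_0(2)[of "(u - t) / h"] \<sigma>_1(2)[of "(u - t) / h"] \<sigma>_2[of "(u - t) / h"] h
      by (auto simp: field_simps)
    show ?thesis
    proof (cases "0 \<le> s")
      case True
      then have "\<sigma>' ((- s - t) / h) = 0"
        using t h by (intro \<sigma>_0) (auto simp: field_simps)
      then show ?thesis
        using one[of s] True h by (auto simp: abs_mult divide_simps)
    next
      case False
      then have "\<sigma>' ((s - t) / h) = 0"
        using t h by (intro \<sigma>_0) (auto simp: field_simps)
      then show ?thesis
        using one[of "- s"] False h by (auto simp: abs_mult divide_simps)
    qed
  qed
  show thesis
  proof (rule that[OF C])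
    show "?\<psi> (f z) = 1" if "t + h \<le> \<bar>f z\<bar>" for z
      by (rule V[OF that])
    show "\<bar>?\<psi>' (f z)\<bar> * g z \<le> 2 / h * (g z * indicator {z. t \<le> \<bar>f z\<bar> \<and> \<bar>f z\<bar> < t + h} z)" for z
      using mult_right_mono[OF W[of "f z"] C1_compact_nonneg[OF fg, of z]]
      by (cases "t \<le> \<bar>f z\<bar> \<and> \<bar>f z\<bar> < t + h") (auto simp: indicator_def mult_ac)
  qed
qed

text \<open>Unlike the power substitution, truncation charges every level only with the part of the gradient
  that lives there; this is what gives the rate \<open>sqrt q\<close> for \<open>p = 2\<close> and the sup bound for \<open>p > 2\<close>.\<close>

definition level :: "('a::euclidean_space \<Rightarrow> real) \<Rightarrow> real \<Rightarrow> real" where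
  "level f t = measure lborel {z. t \<le> \<bar>f z\<bar>}"

lemma level_lmeasurable:
  assumes "C1_compact f g" "0 < t"
  shows "{z. t \<le> \<bar>f z\<bar>} \<in> fmeasurable lborel"
proof -
  have "closed {z. t \<le> \<bar>f z\<bar>}"
    using C1_compact_continuous[OF assms(1)] by (intro closed_Collect_le continuous_intros)
  moreover have "bounded {z. t \<le> \<bar>f z\<bar>}"
    by (rule bounded_subset[OF C1_compact_bounded[OF assms(1)]]) (use assms(2) in auto)
  ultimately show ?thesis
    by (simp add: compact_eq_bounded_closed fmeasurable_compact)
qed

lemma integrable_grad_powr_indicator:
  assumes fg: "C1_compact f g" and p: "0 < p" and S: "S \<in> sets borel"
  shows "integrable lborel (\<lambda>z. g z powr p * indicator S z)"
proof -
  have "integrable lborel (\<lambda>z. \<bar>g z\<bar> powr p)"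
    by (rule integrable_powr_bounded_support[OF C1_compact_continuous_grad[OF fg] C1_compact_bounded_grad[OF fg] p])
  then show ?thesis
    using C1_compact_nonneg[OF fg] S integrable_real_mult_indicator[of S lborel "\<lambda>z. g z powr p"] by simp
qed

text \<open>The truncation is 1 on the upper set and its gradient lives on the band
  \<open>A\<close>. Gagliardo-Nirenberg bounds the measure by the square of the integral of this
  gradient, and Hoelder on \<open>A\<close> brings in \<open>level f t\<close>. The exponent
  \<open>2 - 2 / p\<close> is 1 for \<open>p = 2\<close> and exceeds 1 for \<open>p > 2\<close>;
  this decides between exponential decay and vanishing above a finite level.\<close>

lemma level_decay:
  assumes fg: "C1_compact f g" and t: "0 < t" and h: "0 < h" and p: "1 < p"
  defines "A \<equiv> {z. t \<le> \<bar>f z\<bar> \<and> \<bar>f z\<bar> < t + h}"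
  shows "level f (t + h) \<le> (2 / h)\<^sup>2 * level f t powr (2 - 2 / p)
    * (\<integral>z. g z powr p * indicator A z \<partial>lborel) powr (2 / p)"
proof -
  have g0: "0 \<le> g z" for z by (rule C1_compact_nonneg[OF fg])
  have cf: "continuous_on UNIV f" by (rule C1_compact_continuous[OF fg])
  have [measurable]: "f \<in> borel_measurable borel"
    by (rule borel_measurable_continuous_onI[OF cf])
  have A: "A \<in> sets borel" unfolding A_def by measurable
  obtain v w where vw: "C1_compact v w" and v: "\<And>z. t + h \<le> \<bar>f z\<bar> \<Longrightarrow> v z = 1"
    and "\<And>z. w z \<le> 2 / h * (g z * indicator {z. t \<le> \<bar>f z\<bar> \<and> \<bar>f z\<bar> < t + h} z)"
    by (rule C1_compact_truncate[OF fg less_imp_le[OF t] h that])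
  then have w: "\<And>z. w z \<le> 2 / h * (g z * indicator A z)"
    by (simp add: A_def)
  have gA: "integrable lborel (\<lambda>z. g z * indicator A z)"
    using integrable_grad_powr_indicator[OF fg _ A, of 1] g0 by simp
  have "level f (t + h) = (\<integral>z. indicator {z. t + h \<le> \<bar>f z\<bar>} z \<partial>lborel)"
    by (simp add: level_def)
  also have "\<dots> \<le> (\<integral>z. (v z)\<^sup>2 \<partial>lborel)"
  proof (rule integral_mono)
    show "integrable lborel (indicator {z. t + h \<le> \<bar>f z\<bar>} :: _ \<Rightarrow> real)"
      using level_lmeasurable[OF fg, of "t + h"] t h by (simp add: fmeasurable_def)
    show "integrable lborel (\<lambda>z. (v z)\<^sup>2)"
      using C1_compact_continuous[OF vw] C1_compact_bounded[OF vw]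
      by (intro integrable_continuous_bounded_support) (auto intro!: continuous_intros)
  qed (use v in \<open>auto simp: indicator_def\<close>)
  also have "\<dots> \<le> (\<integral>z. w z \<partial>lborel)\<^sup>2"
    by (rule sobolev_L1[OF vw])
  also have "\<dots> \<le> (2 / h * (\<integral>z. g z * indicator A z \<partial>lborel))\<^sup>2"
  proof (intro power_mono)
    have "(\<integral>z. w z \<partial>lborel) \<le> (\<integral>z. 2 / h * (g z * indicator A z) \<partial>lborel)"
    proof (rule integral_mono)
      show "integrable lborel w"
        by (intro integrable_continuous_bounded_support C1_compact_continuous_grad[OF vw]
            C1_compact_bounded_grad[OF vw])
    qed (use gA w in auto)
    then show "(\<integral>z. w z \<partial>lborel) \<le> 2 / h * (\<integral>z. g z * indicator A z \<partial>lborel)"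
      by simp
    show "0 \<le> (\<integral>z. w z \<partial>lborel)"
      using C1_compact_nonneg[OF vw] by simp
  qed
  also have "\<dots> \<le> (2 / h * (level f t powr (1 - 1 / p) * (\<integral>z. g z powr p * indicator A z \<partial>lborel) powr (1 / p)))\<^sup>2"
  proof (intro power_mono mult_left_mono)
    have Am: "A \<in> fmeasurable lborel"
      by (rule fmeasurableI2[OF level_lmeasurable[OF fg t]]) (use A in \<open>auto simp: A_def\<close>)
    have "(indicator A z) powr (1 - 1 / p) * (g z powr p * indicator A z) powr (1 - (1 - 1 / p)) = g z * indicator A z" for z
      using p g0[of z] by (auto simp: indicator_def powr_powr)
    then have "(\<integral>z. g z * indicator A z \<partial>lborel) \<le> (\<integral>z. indicator A z \<partial>lborel) powr (1 - 1 / p)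
        * (\<integral>z. g z powr p * indicator A z \<partial>lborel) powr (1 - (1 - 1 / p))"
      using holder_inequality[of lborel "indicator A" "\<lambda>z. g z powr p * indicator A z" "1 - 1 / p"]
        Am p g0 integrable_grad_powr_indicator[OF fg _ A, of p] by (simp add: fmeasurable_def)
    also have "\<dots> \<le> level f t powr (1 - 1 / p) * (\<integral>z. g z powr p * indicator A z \<partial>lborel) powr (1 / p)"
    proof -
      have "measure lborel A \<le> level f t"
        unfolding level_def
        by (rule measure_mono_fmeasurable[OF _ _ level_lmeasurable[OF fg t]]) (use A in \<open>auto simp: A_def\<close>)
      then show ?thesis
        using p by (auto intro!: mult_right_mono powr_mono2)
    qed
    finally show "(\<integral>z. g z * indicator A z \<partial>lborel)
      \<le> level f t powr (1 - 1 / p) * (\<integral>z. g z powr p * indicator A z \<partial>lborel) powr (1 / p)" .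
  qed (use h g0 in auto)
  also have "\<dots> = (2 / h)\<^sup>2 * level f t powr (2 - 2 / p) * (\<integral>z. g z powr p * indicator A z \<partial>lborel) powr (2 / p)"
  proof -
    have sq: "(x powr r)\<^sup>2 = x powr (2 * r)" for x r :: real
      by (simp add: power2_eq_square flip: powr_add)
    have "2 * (1 - 1 / p) = 2 - 2 / p" "2 * (1 / p) = 2 / p"
      by (simp_all add: right_diff_distrib)
    then show ?thesis
      by (simp only: power_mult_distrib sq mult.assoc)
  qed
  finally show ?thesis .
qed

lemma C1_compact_bdd:
  assumes "C1_compact f g"
  obtains B where "\<And>z. \<bar>f z\<bar> \<le> B"
proof -
  have "compact (f ` closure {z. f z \<noteq> 0})"
    using C1_compact_continuous[OF assms] C1_compact_bounded[OF assms]
    by (intro compact_continuous_image) (auto intro: continuous_on_subset)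
  then obtain B where B: "\<And>z. z \<in> closure {z. f z \<noteq> 0} \<Longrightarrow> \<bar>f z\<bar> \<le> B"
    using compact_imp_bounded[of "f ` closure {z. f z \<noteq> 0}"] by (auto simp: bounded_iff)
  have "\<bar>f z\<bar> \<le> max 0 B" for z
    using B[of z] closure_subset[of "{z. f z \<noteq> 0}"] by (cases "f z = 0") auto
  then show thesis by (rule that)
qed

lemma level_markov:
  assumes fg: "C1_compact f g" and t: "0 < t" and r: "0 < r"
  shows "level f t * t powr r \<le> (\<integral>z. \<bar>f z\<bar> powr r \<partial>lborel)"
proof -
  have i: "integrable lborel (indicator {z. t \<le> \<bar>f z\<bar>} :: _ \<Rightarrow> real)"
    using level_lmeasurable[OF fg t] by (simp add: fmeasurable_def)
  have "level f t * t powr r = (\<integral>z. t powr r * indicator {z. t \<le> \<bar>f z\<bar>} z \<partial>lborel)"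
    by (simp add: level_def)
  also have "\<dots> \<le> (\<integral>z. \<bar>f z\<bar> powr r \<partial>lborel)"
  proof (rule integral_mono)
    show "integrable lborel (\<lambda>z. \<bar>f z\<bar> powr r)"
      by (rule integrable_powr_bounded_support[OF C1_compact_continuous[OF fg] C1_compact_bounded[OF fg] r])
    show "integrable lborel (\<lambda>z. t powr r * indicator {z. t \<le> \<bar>f z\<bar>} z)"
      using i by simp
  qed (use t r in \<open>auto simp: indicator_def intro: powr_mono2\<close>)
  finally show ?thesis .
qed

text \<open>The decay factors \<open>q * D\<^sub>i / D\<close>, where the \<open>D\<^sub>i\<close> sum up to at most \<open>D\<close>, are multiplied up by
  means of \<open>x \<le> exp (x - 1)\<close>.\<close>

lemma level_exponential_decay:
  assumes fg: "C1_compact f g" and q: "0 < q" and D: "(\<integral>z. g z powr 2 \<partial>lborel) = D" "0 < D"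
  defines "h \<equiv> 2 * sqrt (D / q)"
  shows "level f (real (Suc j) * h) \<le> level f h * exp (q - real j)"
proof -
  \<comment> \<open>This height turns the factor \<open>(2 / h)\<^sup>2\<close> of
    \<open>level_decay\<close> into \<open>q / D\<close>.\<close>
  have h: "0 < h" "h\<^sup>2 = 4 * D / q"
    using q D by (auto simp: h_def power_mult_distrib)
  have [measurable]: "f \<in> borel_measurable borel"
    by (rule borel_measurable_continuous_onI[OF C1_compact_continuous[OF fg]])
  define A where "A i k = {z. real (Suc i) * h \<le> \<bar>f z\<bar> \<and> \<bar>f z\<bar> < real (Suc k) * h}" for i k
  have [measurable]: "A i k \<in> sets borel" for i k
    unfolding A_def by measurable
  define S where "S i k = (\<integral>z. g z powr 2 * indicator (A i k) z \<partial>lborel)" for i k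
  have int: "integrable lborel (\<lambda>z. g z powr 2 * indicator (A i k) z)" for i k
    by (rule integrable_grad_powr_indicator[OF fg]) auto
  have S0: "0 \<le> S i k" for i k
    by (auto simp: S_def)
  \<comment> \<open>The partial integral \<open>S 0 j\<close> stays in the exponent until the end:
    one band may carry all of \<open>D\<close>, so a single step need not bring any decay.\<close>
  have "level f (real (Suc j) * h) \<le> level f h * exp (q * S 0 j / D - real j)"
  proof (induction j)
    case 0
    have "level f h * 1 \<le> level f h * exp (q * S 0 0 / D)"
      using q D S0 by (intro mult_left_mono) (auto simp: level_def)
    then show ?case by simp
  next
    case (Suc j)
    have A: "A j (Suc j) = {z. real (Suc j) * h \<le> \<bar>f z\<bar> \<and> \<bar>f z\<bar> < real (Suc j) * h + h}"
      by (auto simp: A_def algebra_simps)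
    have "S 0 (Suc j) = (\<integral>z. g z powr 2 * indicator (A 0 j) z + g z powr 2 * indicator (A j (Suc j)) z \<partial>lborel)"
      unfolding S_def
    proof (intro Bochner_Integration.integral_cong refl)
      fix z
      have "h * 1 \<le> h * real (Suc j)" "real (Suc j) * h \<le> real (Suc (Suc j)) * h"
        using h by (auto intro!: mult_left_mono mult_right_mono)
      then show "g z powr 2 * indicator (A 0 (Suc j)) z
          = g z powr 2 * indicator (A 0 j) z + g z powr 2 * indicator (A j (Suc j)) z"
        unfolding A_def by (simp add: indicator_def mult.commute[of h])
    qed
    also have "\<dots> = S 0 j + S j (Suc j)"
      using int by (simp add: S_def)
    finally have S: "S 0 (Suc j) = S 0 j + S j (Suc j)" .
    have "level f (real (Suc (Suc j)) * h) = level f (real (Suc j) * h + h)"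
      by (simp add: algebra_simps)
    also have "\<dots> \<le> (2 / h)\<^sup>2 * level f (real (Suc j) * h) powr (2 - 2 / 2) * S j (Suc j) powr (2 / 2)"
      using level_decay[OF fg _ h(1), of "real (Suc j) * h" 2] h(1) unfolding S_def A by simp
    also have "\<dots> = (q * S j (Suc j) / D) * level f (real (Suc j) * h)"
      using S0[of j "Suc j"] h(2) by (simp add: power_divide level_def)
    also have "\<dots> \<le> exp (q * S j (Suc j) / D - 1) * (level f h * exp (q * S 0 j / D - real j))"
      using exp_ge_add_one_self[of "q * S j (Suc j) / D - 1"]
      by (intro mult_mono Suc.IH) (auto simp: level_def)
    also have "\<dots> = level f h * exp (q * S 0 (Suc j) / D - real (Suc j))"
      by (simp add: S exp_add[symmetric] exp_diff[symmetric] algebra_simps add_divide_distrib flip: exp_add)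
    finally show ?case .
  qed
  also have "\<dots> \<le> level f h * exp (q - real j)"
  proof -
    have "S 0 j \<le> D"
      unfolding S_def D(1)[symmetric]
    proof (rule integral_mono[OF int])
      show "integrable lborel (\<lambda>z. g z powr 2)"
        using integrable_grad_powr_indicator[OF fg, of 2 UNIV] by simp
    qed (auto simp: indicator_def)
    then have "q * S 0 j / D \<le> q"
      using q D by (simp add: divide_le_eq)
    then show ?thesis
      by (intro mult_left_mono) (auto simp: level_def)
  qed
  finally show ?thesis .
qed

section \<open>Summation over the levels for p = 2\<close>

context poincare_domain
begin

text \<open>The decay of the levels is used with its parameter equal to the target exponent. Against
  \<open>exp (- x / 2)\<close> the power \<open>x powr q\<close> peaks at \<open>x = 2 * q\<close>,
  that is, where \<open>|f|\<close> is \<open>2 * q * h\<close>, a multiple of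
  \<open>sqrt (q * D)\<close>; this is the origin of \<open>sqrt q\<close>. The part of
  \<open>f\<close> below \<open>h\<close> and the measure of the first level are controlled by the
  integral of the square, which supplies \<open>a\<^sup>2\<close>.\<close>

theorem trudinger:
  assumes fg: "C1_compact f g" and f0: "\<And>z. z \<notin> \<Omega> \<Longrightarrow> f z = 0" and q: "2 \<le> q"
  shows "(\<integral>z. \<bar>f z\<bar> powr q \<partial>lborel) powr (1 / q)
    \<le> 40 * sqrt q * a powr (2 / q) * (\<integral>z. g z powr 2 \<partial>lborel) powr (1 / 2)"
proof -
  define D where "D = (\<integral>z. g z powr 2 \<partial>lborel)"
  define N where "N = (\<integral>z. \<bar>f z\<bar> powr q \<partial>lborel)"
  define N2 where "N2 = (\<integral>z. \<bar>f z\<bar> powr 2 \<partial>lborel)"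
  have nn: "0 \<le> D" "0 \<le> N" "0 \<le> N2"
    by (auto simp: D_def N_def N2_def)
  show ?thesis
    unfolding D_def[symmetric] N_def[symmetric]
  proof (cases "D = 0")
    \<comment> \<open>The layer height \<open>h\<close> would be 0; here the weaker inequality
      already gives 0 on the left.\<close>
    case True
    then show "N powr (1 / q) \<le> 40 * sqrt q * a powr (2 / q) * D powr (1 / 2)"
      using poincare_sobolev[OF fg f0, of 2 q] q by (simp add: D_def N_def)
  next
    case False
    then have D: "0 < D" using nn by simp
    define h where "h = 2 * sqrt (D / q)"
    have h: "0 < h" "h\<^sup>2 = 4 * D / q"
      using q D by (auto simp: h_def power_mult_distrib)
    define \<mu> where "\<mu> j = level f (real (Suc j) * h)" for j
    have \<mu>0: "0 \<le> \<mu> j" for j by (simp add: \<mu>_def level_def)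
    have decay: "\<mu> j \<le> \<mu> 0 * exp (q - real j)" for j
      using level_exponential_decay[OF fg _ D_def[symmetric] D, of q j] q by (simp add: \<mu>_def h_def)
    have "\<mu> 0 * h powr 2 \<le> N2"
      using level_markov[OF fg h(1), of 2] by (simp add: \<mu>_def N2_def)
    then have markov: "\<mu> 0 * h\<^sup>2 \<le> N2" using h by simp
    have N2: "N2 \<le> 4 * a\<^sup>2 * D"
    proof -
      have "N2 powr (1 / 2) \<le> 2 * a * D powr (1 / 2)"
        using poincare_sobolev[OF fg f0, of 2 2] a_pos by (simp add: N2_def D_def)
      then have "(sqrt N2)\<^sup>2 \<le> (2 * a * sqrt D)\<^sup>2"
        using nn a_pos by (intro power_mono) (auto simp: powr_half_sqrt)
      then show ?thesis using nn by (simp add: power_mult_distrib)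
    qed
    obtain B where B: "\<And>z. \<bar>f z\<bar> \<le> B" using C1_compact_bdd[OF fg] by blast
    \<comment> \<open>No point lies above the layers up to \<open>M\<close>, so the layer sum is
      finite.\<close>
    define M where "M = nat \<lceil>B / h\<rceil>"
    \<comment> \<open>From \<open>y \<le> exp (y - 1)\<close> at \<open>y = x / (2 * q)\<close>:
      \<open>x powr q\<close> is at most \<open>(2 * q) powr q * exp (- q) * exp (x / 2)\<close>.
      The factor \<open>exp (- q)\<close> will cancel the \<open>exp q\<close> of the decay, and
      \<open>exp (j / 2)\<close> against \<open>exp (- j)\<close> leaves a geometric series.\<close>
    define c where "c = h powr q * (2 * q) powr q * exp (- q)"
    have c: "0 \<le> c" by (simp add: c_def)
    let ?I = "\<lambda>j z. indicator {z. real (Suc j) * h \<le> \<bar>f z\<bar>} z :: real"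
    have pointwise: "\<bar>f z\<bar> powr q \<le> h powr (q - 2) * \<bar>f z\<bar> powr 2
        + (\<Sum>j\<le>M. c * exp ((real j + 2) / 2) * ?I j z)" for z
    proof (cases "\<bar>f z\<bar> < h")
      case True
      have "\<bar>f z\<bar> powr q = \<bar>f z\<bar> powr (q - 2) * \<bar>f z\<bar> powr 2"
        using powr_add[of "\<bar>f z\<bar>" "q - 2" 2] by simp
      also have "\<dots> \<le> h powr (q - 2) * \<bar>f z\<bar> powr 2"
        using True q by (intro mult_right_mono powr_mono2) auto
      finally show ?thesis
        using c by (simp add: sum_nonneg add_increasing2)
    next
      case False
      define x where "x = \<bar>f z\<bar> / h"
      have x: "1 \<le> x" "\<bar>f z\<bar> = h * x" using False h by (auto simp: x_def)
      \<comment> \<open>The highest layer that contains the point; the shift by 1 is there because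
        layer \<open>j\<close> starts at height \<open>Suc j * h\<close>.\<close>
      define j where "j = nat \<lfloor>x\<rfloor> - 1"
      have "1 \<le> nat \<lfloor>x\<rfloor>" using x by (simp add: le_nat_floor)
      then have j: "real (Suc j) \<le> x" "x \<le> real j + 2"
        using x by (auto simp: j_def of_nat_diff) linarith
      have "x \<le> B / h" using B[of z] h by (simp add: x_def divide_right_mono)
      then have "real j \<le> real M"
        using j real_nat_ceiling_ge[of "B / h"] unfolding M_def by linarith
      then have jM: "j \<in> {..M}" by simp
      have "x / (2 * q) \<le> exp (x / (2 * q) - 1)"
        using exp_ge_add_one_self[of "x / (2 * q) - 1"] by simp
      then have "(x / (2 * q)) powr q \<le> exp (x / (2 * q) - 1) powr q"
        using x q by (intro powr_mono2) auto
      also have "\<dots> = exp (- q) * exp (x / 2)"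
        using q by (simp add: exp_powr_real algebra_simps flip: exp_add)
      finally have "x powr q \<le> (2 * q) powr q * (exp (- q) * exp (x / 2))"
        using x q by (simp add: powr_divide divide_le_eq mult_ac)
      also have "\<dots> \<le> (2 * q) powr q * (exp (- q) * exp ((real j + 2) / 2))"
        using j by (intro mult_left_mono) auto
      finally have "\<bar>f z\<bar> powr q \<le> h powr q * ((2 * q) powr q * (exp (- q) * exp ((real j + 2) / 2)))"
        unfolding x(2) using h x by (subst powr_mult) (auto intro!: mult_left_mono)
      also have "\<dots> = c * exp ((real j + 2) / 2) * ?I j z"
        using j(1) h x(2) by (simp add: c_def indicator_def mult.commute[of h])
      also have "\<dots> \<le> (\<Sum>j\<le>M. c * exp ((real j + 2) / 2) * ?I j z)"
        using c by (intro member_le_sum[OF jM]) auto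
      finally show ?thesis
        by (simp add: add_increasing)
    qed
    have int: "integrable lborel (\<lambda>z. \<bar>f z\<bar> powr q)" "integrable lborel (\<lambda>z. \<bar>f z\<bar> powr 2)"
      using q by (intro integrable_powr_bounded_support C1_compact_continuous[OF fg] C1_compact_bounded[OF fg]; simp)+
    have intI: "integrable lborel (\<lambda>z. ?I j z)" for j
      using level_lmeasurable[OF fg, of "real (Suc j) * h"] h by (simp add: fmeasurable_def)
    have intS: "integrable lborel (\<lambda>z. \<Sum>j\<le>M. c * exp ((real j + 2) / 2) * ?I j z)"
      by (intro Bochner_Integration.integrable_sum integrable_mult_right intI)
    have int2: "integrable lborel (\<lambda>z. h powr (q - 2) * \<bar>f z\<bar> powr 2)"
      by (intro integrable_mult_right int)
    have "N \<le> (\<integral>z. h powr (q - 2) * \<bar>f z\<bar> powr 2 + (\<Sum>j\<le>M. c * exp ((real j + 2) / 2) * ?I j z) \<partial>lborel)"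
      unfolding N_def
      by (rule integral_mono[OF int(1) Bochner_Integration.integrable_add[OF int2 intS] pointwise])
    also have "\<dots> = h powr (q - 2) * N2 + (\<integral>z. (\<Sum>j\<le>M. c * exp ((real j + 2) / 2) * ?I j z) \<partial>lborel)"
      unfolding Bochner_Integration.integral_add[OF int2 intS] N2_def by simp
    also have "(\<integral>z. (\<Sum>j\<le>M. c * exp ((real j + 2) / 2) * ?I j z) \<partial>lborel)
        = (\<Sum>j\<le>M. c * exp ((real j + 2) / 2) * \<mu> j)"
      by (subst Bochner_Integration.integral_sum[OF integrable_mult_right[OF intI]])
        (simp_all add: \<mu>_def level_def)
    finally have N_le: "N \<le> h powr (q - 2) * N2 + (\<Sum>j\<le>M. c * exp ((real j + 2) / 2) * \<mu> j)" .
    have "(\<Sum>j\<le>M. c * exp ((real j + 2) / 2) * \<mu> j)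
        \<le> (\<Sum>j\<le>M. c * exp ((real j + 2) / 2) * (\<mu> 0 * exp (q - real j)))"
      using c by (intro sum_mono mult_left_mono decay) auto
    also have "\<dots> = (\<Sum>j\<le>M. c * \<mu> 0 * exp q * exp 1 * exp (- 1 / 2) ^ j)"
    proof (intro sum.cong refl)
      fix j
      have "exp ((real j + 2) / 2) * exp (q - real j) = exp q * exp 1 * exp (- 1 / 2) ^ j"
        by (simp add: exp_of_nat_mult[symmetric] field_simps flip: exp_add)
      then show "c * exp ((real j + 2) / 2) * (\<mu> 0 * exp (q - real j)) = c * \<mu> 0 * exp q * exp 1 * exp (- 1 / 2) ^ j"
        by (simp add: mult_ac)
    qed
    also have "\<dots> = h powr q * (2 * q) powr q * \<mu> 0 * (exp 1 * (\<Sum>j\<le>M. exp (- 1 / 2) ^ j))"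
    proof -
      have "c * exp q = h powr q * (2 * q) powr q"
        by (simp add: c_def exp_minus)
      moreover have "(\<Sum>j\<le>M. c * \<mu> 0 * exp q * exp 1 * exp (- 1 / 2) ^ j)
          = (c * exp q) * \<mu> 0 * (exp 1 * (\<Sum>j\<le>M. exp (- 1 / 2) ^ j))"
        unfolding sum_distrib_left by (intro sum.cong refl) (simp only: mult_ac)
      ultimately show ?thesis by simp
    qed
    also have "\<dots> \<le> h powr q * (2 * q) powr q * \<mu> 0 * (3 * 3)"
    proof (intro mult_left_mono mult_mono)
      show "exp 1 \<le> (3 :: real)" by (rule exp_le)
      have "1 + 1 / 2 \<le> exp (1 / 2 :: real)" by (rule exp_ge_add_one_self)
      then have x: "exp (- 1 / 2 :: real) \<le> 2 / 3"
        by (simp add: exp_minus field_simps)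
      have "(\<Sum>j\<le>M. exp (- 1 / 2 :: real) ^ j) \<le> (\<Sum>j. exp (- 1 / 2 :: real) ^ j)"
        using x by (intro sum_le_suminf summable_geometric) auto
      also have "\<dots> = 1 / (1 - exp (- 1 / 2 :: real))"
        using x by (intro suminf_geometric) auto
      also have "\<dots> \<le> 1 / (1 - 2 / 3)"
        using x by (intro divide_left_mono) auto
      finally show "(\<Sum>j\<le>M. exp (- 1 / 2 :: real) ^ j) \<le> 3" by simp
    qed (use \<mu>0 in \<open>auto intro!: sum_nonneg\<close>)
    also have "\<dots> = 9 * (2 * q) powr q * h powr (q - 2) * (\<mu> 0 * h\<^sup>2)"
      using h(1) by (simp add: powr_diff)
    finally have "N \<le> h powr (q - 2) * N2 + 9 * (2 * q) powr q * h powr (q - 2) * (\<mu> 0 * h\<^sup>2)"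
      using N_le by linarith
    also have "\<dots> \<le> (2 * q) powr q * h powr (q - 2) * N2 + 9 * (2 * q) powr q * h powr (q - 2) * N2"
    proof (intro add_mono mult_left_mono mult_right_mono markov)
      have "1 \<le> (2 * q) powr q" using q by (intro ge_one_powr_ge_zero) auto
      then show "h powr (q - 2) \<le> (2 * q) powr q * h powr (q - 2)"
        by (simp add: mult_le_cancel_right1)
    qed (use nn in auto)
    also have "\<dots> = 10 * (2 * q) powr q * h powr (q - 2) * N2" by simp
    also have "\<dots> \<le> 10 * (2 * q) powr q * h powr (q - 2) * (4 * a\<^sup>2 * D)"
      by (intro mult_left_mono N2) auto
    also have "\<dots> = (10 * q) * (a\<^sup>2 * (2 * q * h) powr q)"
    proof -
      have "4 * D = q * h\<^sup>2"
        using h(2) q by simp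
      then have "h powr (q - 2) * (4 * D) = q * h powr q"
        using h(1) by (simp only: powr_diff) simp
      moreover have "(2 * q * h) powr q = (2 * q) powr q * h powr q"
        using h q by (simp add: powr_mult)
      ultimately show ?thesis
        by (simp add: algebra_simps)
    qed
    \<comment> \<open>The factor \<open>10 * q\<close> is absorbed into a \<open>q\<close>-th power,
      so that the root costs only 10; with \<open>2 * q * h = 4 * sqrt q * sqrt D\<close> this makes
      40.\<close>
    also have "\<dots> \<le> 10 powr q * (a\<^sup>2 * (2 * q * h) powr q)"
    proof (rule mult_right_mono)
      have "1 + (q - 1) * 1 \<le> 1 + (q - 1) * ln 10"
        using q ln_ge_iff[of 10 1] exp_le by (intro add_left_mono mult_left_mono) auto
      also have "\<dots> \<le> exp ((q - 1) * ln 10)"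
        by (rule exp_ge_add_one_self)
      also have "\<dots> = 10 powr (q - 1)"
        by (simp add: powr_def)
      finally show "10 * q \<le> 10 powr q" by (simp add: powr_diff)
    qed simp
    finally have "N \<le> 10 powr q * a\<^sup>2 * (2 * q * h) powr q"
      by (simp add: mult.assoc)
    then have "N powr (1 / q) \<le> (10 powr q * a\<^sup>2 * (2 * q * h) powr q) powr (1 / q)"
      using nn q by (intro powr_mono2) auto
    also have "\<dots> = 10 * (a\<^sup>2) powr (1 / q) * (2 * q * h)"
      using q h by (simp add: powr_mult powr_powr)
    also have "(a\<^sup>2) powr (1 / q) = a powr (2 / q)"
      using a_pos powr_powr[of a 2 "1 / q"] by simp
    also have "2 * q * h = 4 * sqrt q * D powr (1 / 2)"
      using q D real_sqrt_mult_self[of q] by (simp add: h_def real_sqrt_divide powr_half_sqrt field_simps)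
    finally show "N powr (1 / q) \<le> 40 * sqrt q * a powr (2 / q) * D powr (1 / 2)"
      by (simp add: mult_ac)
  qed
qed

end

section \<open>The supremum for p > 2\<close>

context poincare_domain
begin

text \<open>De Giorgi iteration over levels whose increments shrink geometrically.\<close>

theorem sup_bound:
  assumes fg: "C1_compact f g" and f0: "\<And>z. z \<notin> \<Omega> \<Longrightarrow> f z = 0" and p: "2 < p"
    and G0: "0 < (\<integral>z. g z powr p \<partial>lborel)"
  defines "\<delta> \<equiv> 1 - 2 / p"
  defines "C \<equiv> 1 + sqrt 8 * (p powr p) powr (\<delta> / 2) / (1 - 2 powr (- \<delta> / 2))"
  shows "\<bar>f z\<bar> \<le> C * a powr \<delta> * (\<integral>z. g z powr p \<partial>lborel) powr (1 / p)"
proof (rule ccontr)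
  define I where "I = (\<integral>z. g z powr p \<partial>lborel)"
  define G where "G = I powr (1 / p)"
  \<comment> \<open>At the level \<open>t0\<close> the measure is at most \<open>m\<close>.
    \<open>H\<close> and \<beta> are chosen so that the step \<open>h = H * \<beta> ^ j\<close>
    halves the bound \<open>m * (1/2) ^ j\<close>: the surplus \<delta> in the exponent
    \<open>1 + \<delta>\<close> of \<open>level_decay\<close> supplies
    \<open>(\<beta> ^ j)\<^sup>2\<close>, which cancels against \<open>h\<^sup>2\<close>. The 8 is 4
    from \<open>(2 / h)\<^sup>2\<close> times 2 for the halving.\<close>
  define t0 where "t0 = a powr \<delta> * G"
  define m where "m = p powr p * a\<^sup>2"
  define H where "H = sqrt 8 * m powr (\<delta> / 2) * G"
  define \<beta> :: real where "\<beta> = 2 powr (- \<delta> / 2)"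
  define t where "t j = t0 + H * (\<Sum>i<j. \<beta> ^ i)" for j
  have \<delta>: "0 < \<delta>" "2 - 2 / p = 1 + \<delta>" "p * (1 - \<delta>) = 2"
    using p by (auto simp: \<delta>_def field_simps)
  have I: "0 < I" using G0 by (simp add: I_def)
  then have pos: "0 < G" "0 < t0" "0 < m" "0 < H"
    using a_pos p by (auto simp: G_def t0_def m_def H_def)
  have \<beta>: "0 < \<beta>" "\<beta> < 1"
    using \<delta> by (auto simp: \<beta>_def powr_less_one)
  have t_pos: "0 < t j" for j
    unfolding t_def using pos \<beta> by (intro add_pos_nonneg mult_nonneg_nonneg sum_nonneg) auto
  \<comment> \<open>Markov's inequality combined with \<open>poincare_sobolev\<close> for
    \<open>q = p\<close>, where its constant is \<open>p\<close> and the power of \<open>a\<close>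
    is 1.\<close>
  have level0: "level f t0 \<le> m"
  proof -
    have "(\<integral>z. \<bar>f z\<bar> powr p \<partial>lborel) powr (1 / p) \<le> p * a * G"
      using poincare_sobolev[OF fg f0, of p p] p a_pos
      by (simp add: G_def I_def right_diff_distrib)
    then have "((\<integral>z. \<bar>f z\<bar> powr p \<partial>lborel) powr (1 / p)) powr p \<le> (p * a * G) powr p"
      using p by (intro powr_mono2) auto
    then have "(\<integral>z. \<bar>f z\<bar> powr p \<partial>lborel) \<le> (p * a * G) powr p"
      using p by (simp add: powr_powr)
    then have "level f t0 * t0 powr p \<le> (p * a * G) powr p"
      using level_markov[OF fg pos(2), of p] p by linarith
    also have "p * a * G = t0 * (p * a powr (1 - \<delta>))"
      using a_pos by (simp add: t0_def powr_diff)
    also have "\<dots> powr p = m * t0 powr p"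
      using p a_pos pos \<delta>(3) by (simp add: powr_mult powr_powr m_def mult_ac)
    finally show ?thesis using pos by simp
  qed
  have decay: "level f (t j) \<le> m * (1 / 2) ^ j" for j
  proof (induction j)
    case 0
    then show ?case using level0 by (simp add: t_def)
  next
    case (Suc j)
    define h where "h = H * \<beta> ^ j"
    have h: "0 < h" using pos \<beta> by (simp add: h_def)
    let ?A = "{z. t j \<le> \<bar>f z\<bar> \<and> \<bar>f z\<bar> < t j + h}"
    have "?A \<in> sets borel"
    proof -
      have [measurable]: "f \<in> borel_measurable borel"
        by (rule borel_measurable_continuous_onI[OF C1_compact_continuous[OF fg]])
      show ?thesis by measurable
    qed
    then have "(\<integral>z. g z powr p * indicator ?A z \<partial>lborel) \<le> (\<integral>z. g z powr p * indicator UNIV z \<partial>lborel)"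
      using p by (intro integral_mono integrable_grad_powr_indicator[OF fg]) (auto simp: indicator_def)
    then have "(\<integral>z. g z powr p * indicator ?A z \<partial>lborel) powr (2 / p) \<le> I powr (2 / p)"
      using p by (intro powr_mono2) (auto simp: I_def)
    also have "I powr (2 / p) = G\<^sup>2"
      by (simp add: G_def power2_eq_square flip: powr_add)
    finally have IA: "(\<integral>z. g z powr p * indicator ?A z \<partial>lborel) powr (2 / p) \<le> G\<^sup>2" .
    have "level f (t (Suc j)) = level f (t j + h)"
      by (simp add: t_def h_def algebra_simps)
    also have "\<dots> \<le> (2 / h)\<^sup>2 * level f (t j) powr (1 + \<delta>) * (\<integral>z. g z powr p * indicator ?A z \<partial>lborel) powr (2 / p)"
      using level_decay[OF fg t_pos h, of p] p unfolding \<delta>(2) by simp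
    also have "\<dots> \<le> (2 / h)\<^sup>2 * (m * (1 / 2) ^ j) powr (1 + \<delta>) * G\<^sup>2"
      using IA Suc.IH \<delta> by (intro mult_mono powr_mono2) (auto simp: level_def)
    also have "(m * (1 / 2) ^ j) powr (1 + \<delta>) = (m * (1 / 2) ^ j) * (m powr \<delta> * (\<beta> ^ j)\<^sup>2)"
    proof -
      have "((1 / 2) ^ j) powr \<delta> = ((1 / 2 :: real) powr \<delta>) ^ j"
        by (simp add: powr_power powr_powr mult.commute flip: powr_realpow)
      also have "(1 / 2 :: real) powr \<delta> = \<beta>\<^sup>2"
        by (simp add: \<beta>_def power2_eq_square powr_minus_divide powr_divide flip: powr_add)
      finally have "((1 / 2 :: real) ^ j) powr \<delta> = (\<beta> ^ j)\<^sup>2"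
        by (simp add: power_mult[symmetric] mult.commute)
      then show ?thesis
        using pos by (simp add: powr_add powr_mult)
    qed
    also have "(2 / h)\<^sup>2 * ((m * (1 / 2) ^ j) * (m powr \<delta> * (\<beta> ^ j)\<^sup>2)) * G\<^sup>2 = m * (1 / 2) ^ Suc j"
    proof -
      have "H\<^sup>2 = 8 * m powr \<delta> * G\<^sup>2"
        by (simp add: H_def power_mult_distrib power2_eq_square[of "m powr (\<delta> / 2)"] flip: powr_add)
      define K where "K = m powr \<delta> * (\<beta> ^ j)\<^sup>2 * G\<^sup>2"
      have K: "h\<^sup>2 = 8 * K" "0 < K"
        using \<open>H\<^sup>2 = _\<close> pos \<beta> by (simp_all add: h_def K_def power_mult_distrib)
      have "(2 / h)\<^sup>2 * ((m * (1 / 2) ^ j) * (m powr \<delta> * (\<beta> ^ j)\<^sup>2)) * G\<^sup>2 = m * (1 / 2) ^ j * (4 * K / h\<^sup>2)"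
        by (simp add: K_def power_divide mult_ac)
      also have "4 * K / h\<^sup>2 = 1 / 2"
        using K by simp
      finally show ?thesis by simp
    qed
    finally show ?case .
  qed
  define T where "T = t0 + H / (1 - \<beta>)"
  have tT: "t j \<le> T" for j
  proof -
    have "(\<Sum>i<j. \<beta> ^ i) \<le> (\<Sum>i. \<beta> ^ i)"
      using \<beta> by (intro sum_le_suminf summable_geometric) auto
    also have "\<dots> = 1 / (1 - \<beta>)"
      using \<beta> by (intro suminf_geometric) auto
    finally show ?thesis
      using pos by (simp add: t_def T_def) (metis mult_left_mono less_imp_le times_divide_eq_right mult.right_neutral)
  qed
  have T: "T = C * a powr \<delta> * G"
  proof -
    have "m powr (\<delta> / 2) = (p powr p) powr (\<delta> / 2) * a powr \<delta>"
      using a_pos powr_powr[of a 2 "\<delta> / 2"] by (simp add: m_def powr_mult)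
    then show ?thesis
      by (simp add: T_def t0_def C_def H_def \<beta>_def algebra_simps)
  qed
  assume "\<not> \<bar>f z\<bar> \<le> C * a powr \<delta> * (\<integral>z. g z powr p \<partial>lborel) powr (1 / p)"
  then have fz: "T < \<bar>f z\<bar>"
    by (simp add: T G_def I_def)
  \<comment> \<open>An excess over \<open>T\<close> persists on a ball. All levels
    \<open>t j\<close> lie below \<open>T\<close>, so the ball is contained in sets whose measure
    tends to 0.\<close>
  have "open {w. T < \<bar>f w\<bar>}"
    using C1_compact_continuous[OF fg] by (intro open_Collect_less continuous_intros)
  then obtain r where r: "0 < r" "ball z r \<subseteq> {w. T < \<bar>f w\<bar>}"
    using fz open_contains_ball by blast
  have "measure lborel (ball z r) \<le> m * (1 / 2) ^ j" for j
  proof -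
    have "measure lborel (ball z r) \<le> level f (t j)"
      unfolding level_def
      by (rule measure_mono_fmeasurable[OF _ _ level_lmeasurable[OF fg t_pos]]) (use r tT[of j] in fastforce)+
    then show ?thesis using decay[of j] by linarith
  qed
  moreover have "(\<lambda>j. m * (1 / 2) ^ j) \<longlonglongrightarrow> m * 0"
    by (intro tendsto_mult tendsto_const LIMSEQ_power_zero) simp
  ultimately have "measure lborel (ball z r) \<le> 0"
    using LIMSEQ_le_const[of "\<lambda>j. m * (1 / 2) ^ j" "m * 0"] by simp
  then show False
    using content_ball_pos[OF r(1), of z] by simp
qed

end

section \<open>Transfer to test functions on the plane\<close>

definition of_pair :: "real \<times> real \<Rightarrow> real^2" where
  "of_pair z = fst z *\<^sub>R axis 1 1 + snd z *\<^sub>R axis 2 1"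

definition to_pair :: "real^2 \<Rightarrow> real \<times> real" where
  "to_pair v = (v $ 1, v $ 2)"

lemma of_pair_nth [simp]: "of_pair z $ 1 = fst z" "of_pair z $ 2 = snd z"
  by (simp_all add: of_pair_def axis_def)

lemma of_pair_to_pair [simp]: "of_pair (to_pair v) = v"
  by (simp add: vec_eq_iff forall_2 to_pair_def)

lemma to_pair_of_pair [simp]: "to_pair (of_pair z) = z"
  by (simp add: to_pair_def)

lemma continuous_of_pair: "continuous_on S of_pair"
  unfolding of_pair_def[abs_def] by (intro continuous_intros)

lemma continuous_to_pair: "continuous_on S to_pair"
  unfolding to_pair_def[abs_def] by (intro continuous_intros)

lemma Basis_vec_2: "(Basis :: (real^2) set) = {axis 1 1, axis 2 1}"
  by (auto simp: Basis_vec_def UNIV_2)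

lemma axis_1_neq_axis_2: "(axis 1 1 :: real^2) \<noteq> axis 2 1"
  by (simp add: axis_eq_axis)

lemma lborel_of_pair: "distr lborel borel of_pair = lborel"
proof -
  have m: "of_pair \<in> borel_measurable lborel"
    using borel_measurable_continuous_onI[OF continuous_of_pair] by simp
  have "lborel = distr lborel borel of_pair"
  proof (rule lborel_eqI)
    fix l u :: "real^2" assume le: "\<And>b. b \<in> Basis \<Longrightarrow> l \<bullet> b \<le> u \<bullet> b"
    have "l $ 1 \<le> u $ 1" "l $ 2 \<le> u $ 2"
      using le[of "axis 1 1"] le[of "axis 2 1"] by (auto simp: Basis_vec_2 inner_axis)
    moreover have "of_pair -` box l u = {l $ 1<..<u $ 1} \<times> {l $ 2<..<u $ 2}"
      by (auto simp: mem_box_cart forall_2)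
    then have "emeasure (distr lborel borel of_pair) (box l u)
        = emeasure (lborel \<Otimes>\<^sub>M lborel) ({l $ 1<..<u $ 1} \<times> {l $ 2<..<u $ 2})"
      using m by (simp add: emeasure_distr lborel_prod)
    ultimately show "emeasure (distr lborel borel of_pair) (box l u) = ennreal (\<Prod>b\<in>Basis. (u - l) \<bullet> b)"
      using axis_1_neq_axis_2
      by (simp add: lborel.emeasure_pair_measure_Times Basis_vec_2 inner_axis ennreal_mult)
  qed simp
  then show ?thesis ..
qed

text \<open>Vanishing off \<Omega> removes the restriction to \<Omega>, Borel measurability the
  completion of the measure; the rest is the change of variables.\<close>

lemma integral_lebesgue_on_of_pair:
  fixes h :: "real^2 \<Rightarrow> real"
  assumes h: "h \<in> borel_measurable borel" and \<Omega>: "open \<Omega>" and 0: "\<And>x. x \<notin> \<Omega> \<Longrightarrow> h x = 0"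
  shows "(\<integral>x. h x \<partial>lebesgue_on \<Omega>) = (\<integral>z. h (of_pair z) \<partial>lborel)"
proof -
  have m: "of_pair \<in> borel_measurable lborel"
    using borel_measurable_continuous_onI[OF continuous_of_pair] by simp
  have "(\<integral>x. h x \<partial>lebesgue_on \<Omega>) = (\<integral>x. indicator \<Omega> x *\<^sub>R h x \<partial>lebesgue)"
    using \<Omega> by (intro integral_restrict_space) auto
  also have "\<dots> = (\<integral>x. h x \<partial>lebesgue)"
    by (intro Bochner_Integration.integral_cong) (auto simp: 0 indicator_def)
  also have "\<dots> = (\<integral>x. h x \<partial>lborel)"
    using h by (intro integral_completion) simp
  also have "\<dots> = (\<integral>x. h x \<partial>distr lborel borel of_pair)"
    by (simp add: lborel_of_pair)
  also have "\<dots> = (\<integral>z. h (of_pair z) \<partial>lborel)"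
    by (rule integral_distr[OF m h])
  finally show ?thesis .
qed

text \<open>\<open>gradient\<close> is a definite description, so its components become accessible
  only once existence and uniqueness are known.\<close>

lemma gradient_eq:
  fixes u :: "'a::euclidean_space \<Rightarrow> real"
  assumes "u differentiable (at x)"
  shows "gradient u x = (\<Sum>i\<in>Basis. frechet_derivative u (at x) i *\<^sub>R i)"
proof -
  define F where "F = frechet_derivative u (at x)"
  define D where "D = (\<Sum>i\<in>Basis. F i *\<^sub>R i)"
  have F: "(u has_derivative F) (at x)"
    using assms by (simp add: F_def frechet_derivative_works)
  have lin: "linear F"
    by (rule has_derivative_linear[OF F])
  have "F = (\<lambda>h. inner h D)"
  proof
    fix h
    have "F h = F (\<Sum>i\<in>Basis. (h \<bullet> i) *\<^sub>R i)"
      by (simp add: euclidean_representation)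
    also have "\<dots> = (\<Sum>i\<in>Basis. (h \<bullet> i) * F i)"
      by (simp add: linear_sum[OF lin] linear_scale[OF lin])
    also have "\<dots> = inner h D"
      by (simp add: D_def inner_sum_right mult.commute)
    finally show "F h = inner h D" .
  qed
  then have D: "GDERIV u x :> D"
    using F by (simp add: gderiv_def)
  have "E = D" if "GDERIV u x :> E" for E
  proof -
    have "(\<lambda>h. inner h E) = (\<lambda>h. inner h D)"
      using that D unfolding gderiv_def by (rule has_derivative_unique)
    then have "inner (E - D) (E - D) = 0"
      by (metis cancel_comm_monoid_add_class.diff_cancel inner_diff_right)
    then show ?thesis by simp
  qed
  then show ?thesis
    unfolding gradient_def D_def[symmetric] F_def[symmetric] using D by (intro the_equality)
qed

lemma C1_compact_test_function:
  assumes u: "u \<in> test_functions (\<Omega> :: (real^2) set)"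
  shows "C1_compact (\<lambda>z. u (of_pair z)) (\<lambda>z. norm (gradient u (of_pair z)))"
proof -
  define F where "F x = frechet_derivative u (at x)" for x
  have C2: "C_k (Suc (Suc 0)) u"
    using u by (simp only: test_functions_def mem_Collect_eq)
  then have diff: "\<And>x. u differentiable (at x)"
    and diffF: "\<And>x i. i \<in> Basis \<Longrightarrow> (\<lambda>x. F x i) differentiable (at x)"
    by (auto simp: F_def)
  have cu: "continuous_on UNIV u"
    using diff by (auto simp: continuous_on_eq_continuous_at intro: differentiable_imp_continuous_within)
  have cF: "continuous_on UNIV (\<lambda>x. F x i)" if "i \<in> Basis" for i
    using diffF[OF that] by (auto simp: continuous_on_eq_continuous_at intro: differentiable_imp_continuous_within)
  have der: "((\<lambda>t. u (w + t *\<^sub>R e)) has_real_derivative F (w + t *\<^sub>R e) e) (at t)" for w e t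
  proof -
    have F: "(u has_derivative F (w + t *\<^sub>R e)) (at (w + t *\<^sub>R e))"
      using diff by (simp add: F_def frechet_derivative_works)
    have "((\<lambda>t. w + t *\<^sub>R e) has_derivative (\<lambda>h. h *\<^sub>R e)) (at t)"
      by (auto intro!: derivative_eq_intros)
    then have "((\<lambda>t. u (w + t *\<^sub>R e)) has_derivative (\<lambda>h. F (w + t *\<^sub>R e) (h *\<^sub>R e))) (at t)"
      by (rule has_derivative_compose[where f = "\<lambda>t. w + t *\<^sub>R e" and x = t, OF _ F])
    then show ?thesis
      by (simp add: has_field_derivative_def linear_scale[OF has_derivative_linear[OF F]]
          mult_commute_abs)
  qed
  have "bounded (closure {x. u x \<noteq> 0})"
    using u by (auto simp: test_functions_def compact_imp_bounded)
  then have cl: "compact (to_pair ` closure {x. u x \<noteq> 0})"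
    by (intro compact_continuous_image continuous_to_pair) (simp add: compact_eq_bounded_closed)
  have bd: "bounded {z. u (of_pair z) \<noteq> 0}"
  proof (rule bounded_subset[OF compact_imp_bounded[OF cl]])
    show "{z. u (of_pair z) \<noteq> 0} \<subseteq> to_pair ` closure {x. u x \<noteq> 0}"
      using closure_subset[of "{x. u x \<noteq> 0}"] by (force simp: image_iff intro: bexI[of _ "of_pair z" for z])
  qed
  show ?thesis
    unfolding C1_compact_def
  proof (intro conjI bd)
    show "continuous_on UNIV (\<lambda>z. u (of_pair z))"
      by (rule continuous_on_compose2[OF cu continuous_of_pair]) simp
    have "continuous_on UNIV (\<lambda>z. F (of_pair z) (axis 1 1))" "continuous_on UNIV (\<lambda>z. F (of_pair z) (axis 2 1))"
      by (rule continuous_on_compose2[OF cF continuous_of_pair]; simp add: Basis_vec_2)+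
    moreover have "((\<lambda>x. u (of_pair (x, y))) has_real_derivative F (of_pair (x, y)) (axis 1 1)) (at x)" for x y
      using der[of "y *\<^sub>R axis 2 1" "axis 1 1" x] by (simp add: of_pair_def add.commute)
    moreover have "((\<lambda>y. u (of_pair (x, y))) has_real_derivative F (of_pair (x, y)) (axis 2 1)) (at y)" for x y
      using der[of "x *\<^sub>R axis 1 1" "axis 2 1" y] by (simp add: of_pair_def)
    moreover have "norm (gradient u x) = sqrt ((F x (axis 1 1))\<^sup>2 + (F x (axis 2 1))\<^sup>2)" for x
      using axis_1_neq_axis_2 unfolding gradient_eq[OF diff] F_def[symmetric]
      by (simp add: Basis_vec_2 norm_vec_def L2_set_def UNIV_2 axis_def)
    ultimately show "\<exists>f1 f2. continuous_on UNIV f1 \<and> continuous_on UNIV f2 \<and>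
       (\<forall>x y. ((\<lambda>x. u (of_pair (x, y))) has_real_derivative f1 (x, y)) (at x)) \<and>
       (\<forall>x y. ((\<lambda>y. u (of_pair (x, y))) has_real_derivative f2 (x, y)) (at y)) \<and>
       (\<lambda>z. norm (gradient u (of_pair z))) = (\<lambda>z. sqrt ((f1 z)\<^sup>2 + (f2 z)\<^sup>2))"
      by blast
  qed
qed

lemma test_function_zero_outside:
  assumes u: "u \<in> test_functions (\<Omega> :: (real^2) set)" and x: "x \<notin> \<Omega>"
  shows "u x = 0" "norm (gradient u x) = 0"
proof -
  have cl: "closure {x. u x \<noteq> 0} \<subseteq> \<Omega>"
    using u by (simp add: test_functions_def)
  then show "u x = 0"
    using x closure_subset[of "{x. u x \<noteq> 0}"] by auto
  have "{z. u (of_pair z) \<noteq> 0} \<subseteq> of_pair -` closure {x. u x \<noteq> 0}"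
    using closure_subset[of "{x. u x \<noteq> 0}"] by auto
  moreover have "closed (of_pair -` closure {x. u x \<noteq> 0})"
    by (intro closed_vimage continuous_of_pair closed_closure)
  ultimately have "closure {z. u (of_pair z) \<noteq> 0} \<subseteq> of_pair -` closure {x. u x \<noteq> 0}"
    by (rule closure_minimal)
  then have "to_pair x \<notin> closure {z. u (of_pair z) \<noteq> 0}"
    using cl x by auto
  from C1_compact_grad_zero[OF C1_compact_test_function[OF u] this]
  show "norm (gradient u x) = 0" by simp
qed

text \<open>A ball with twice the inradius as its radius does not fit into \<Omega>, so it contains
  a hole. The factor 2 provides a radius strictly above the supremum. The open squares around the
  holes serve as the separating sets, their frontiers being the squares assumed to lie in
  \<Omega>.\<close>

lemma perforated_plane_of_pair:
  assumes \<Omega>: "multiply_connected_of_order k \<Omega>" and ne: "\<Omega> \<noteq> {}" and fin: "inradius \<Omega> < \<infinity>"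
  shows "0 < enn2real (inradius \<Omega>)"
    and "perforated_plane (of_pair -` \<Omega>) k (2 * enn2real (inradius \<Omega>))"
proof -
  define \<rho> where "\<rho> = enn2real (inradius \<Omega>)"
  have op: "open \<Omega>" using \<Omega> by (simp add: multiply_connected_of_order_def)
  have \<rho>: "inradius \<Omega> = ennreal \<rho>" using fin by (simp add: \<rho>_def)
  have ball_le: "r \<le> \<rho>" if "0 < r" "ball x r \<subseteq> \<Omega>" for r x
  proof -
    have "ennreal r \<le> inradius \<Omega>"
      unfolding inradius_def using that by (intro SUP_upper) auto
    then show ?thesis
      using that by (simp add: \<rho> ennreal_le_iff2)
  qed
  obtain x r where "0 < r" "ball x r \<subseteq> \<Omega>"
    using ne op open_contains_ball by blast
  then have \<rho>0: "0 < \<rho>" using ball_le by fastforce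
  then show "0 < enn2real (inradius \<Omega>)" by (simp add: \<rho>_def)
  have "perforated_plane (of_pair -` \<Omega>) k (2 * \<rho>)"
  proof
    show "open (of_pair -` \<Omega>)"
      by (intro open_vimage op continuous_of_pair)
    show "0 < 2 * \<rho>" using \<rho>0 by simp
    fix c
    have "\<not> ball (of_pair c) (2 * \<rho>) \<subseteq> \<Omega>"
      using ball_le[of "2 * \<rho>" "of_pair c"] \<rho>0 by auto
    then obtain w where w: "w \<notin> \<Omega>" "dist (of_pair c) w < 2 * \<rho>" by (auto simp: subset_iff)
    have "\<bar>(w - of_pair c) $ i\<bar> < 2 * \<rho>" for i
      using component_le_norm_cart[of "w - of_pair c" i] w(2) by (simp add: dist_norm norm_minus_commute)
    from this[of 1] this[of 2] have "sup_dist c (to_pair w) < 2 * \<rho>"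
      by (simp add: to_pair_def)
    then show "\<exists>z. z \<notin> of_pair -` \<Omega> \<and> sup_dist c z < 2 * \<rho>"
      using w(1) by (intro exI[of _ "to_pair w"]) simp
  next
    fix Z \<sigma>
    assume Z: "\<And>z. z \<in> Z \<Longrightarrow> z \<notin> of_pair -` \<Omega> \<and> 0 < \<sigma> z \<and> (\<forall>w. sup_dist z w = \<sigma> z \<longrightarrow> w \<in> of_pair -` \<Omega>)"
      and sep: "\<And>z w. z \<in> Z \<Longrightarrow> w \<in> Z \<Longrightarrow> z \<noteq> w \<Longrightarrow> \<sigma> z \<le> sup_dist z w"
    define U where "U v = {w. sup_dist (to_pair v) (to_pair w) < \<sigma> (to_pair v)}" for v
    have "card (of_pair ` Z) \<le> k"
    proof (rule card_separated_le_order[OF \<Omega>, of _ U])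
      fix v assume "v \<in> of_pair ` Z"
      then have v: "to_pair v \<in> Z" by auto
      let ?\<sigma> = "\<sigma> (to_pair v)"
      have c: "continuous_on UNIV (\<lambda>w. sup_dist (to_pair v) (to_pair w))"
        unfolding to_pair_def by (auto intro!: continuous_intros)
      have o: "open (U v)"
        unfolding U_def by (intro open_Collect_less c continuous_intros)
      have "closure (U v) \<subseteq> {w. sup_dist (to_pair v) (to_pair w) \<le> ?\<sigma>}"
        by (intro closure_minimal closed_Collect_le c continuous_intros) (auto simp: U_def)
      then have "frontier (U v) \<subseteq> {w. sup_dist (to_pair v) (to_pair w) = ?\<sigma>}"
        using o unfolding frontier_def U_def by (auto simp: interior_open)
      then have fr: "frontier (U v) \<subseteq> \<Omega>"
        using Z[OF v] by fastforce
      have "U v \<subseteq> of_pair ` cbox (to_pair v - (?\<sigma>, ?\<sigma>)) (to_pair v + (?\<sigma>, ?\<sigma>))"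
      proof
        fix w assume "w \<in> U v"
        then have "to_pair w \<in> cbox (to_pair v - (?\<sigma>, ?\<sigma>)) (to_pair v + (?\<sigma>, ?\<sigma>))"
          by (auto simp: U_def to_pair_def cbox_Pair_iff)
        then show "w \<in> of_pair ` cbox (to_pair v - (?\<sigma>, ?\<sigma>)) (to_pair v + (?\<sigma>, ?\<sigma>))"
          by (metis imageI of_pair_to_pair)
      qed
      then have "bounded (U v)"
        by (rule bounded_subset[rotated])
          (intro compact_imp_bounded compact_continuous_image continuous_of_pair compact_cbox)
      then show "v \<notin> \<Omega> \<and> v \<in> U v \<and> open (U v) \<and> bounded (U v) \<and> frontier (U v) \<subseteq> \<Omega>"
        using Z[OF v] o fr by (simp add: U_def)
      fix v' assume "v' \<in> of_pair ` Z" "v \<noteq> v'"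
      then have "to_pair v' \<in> Z" "to_pair v \<noteq> to_pair v'"
        by (auto, metis of_pair_to_pair to_pair_of_pair)
      then show "v' \<notin> U v"
        using sep[OF v, of "to_pair v'"] by (auto simp: U_def)
    qed
    moreover have "inj_on of_pair Z"
      by (metis inj_onI to_pair_of_pair)
    ultimately show "card Z \<le> k"
      by (simp add: card_image)
  qed
  then show "perforated_plane (of_pair -` \<Omega>) k (2 * enn2real (inradius \<Omega>))"
    by (simp add: \<rho>_def)
qed

text \<open>Here \<open>x\<close> is the norm of a test function and \<open>y\<close> that of its
  gradient. Inverting the Sobolev estimate is what makes \<Theta> the power \<open>- p\<close> of
  its constant.\<close>

lemma rayleigh_lower_bound:
  fixes x y R K p e :: real
  assumes "0 < x" "0 \<le> y" "0 < R" "0 < K" "0 < p" and le: "x \<le> K * R powr e * y"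
  shows "K powr (- p) * (1 / R) powr (p * e) \<le> y powr p / x powr p"
proof -
  have "x powr p \<le> (K * R powr e * y) powr p"
    using assms by (intro powr_mono2) auto
  also have "\<dots> = K powr p * R powr (p * e) * y powr p"
    using assms by (simp add: powr_mult powr_powr mult.commute)
  finally show ?thesis
    using assms by (simp add: powr_minus_divide powr_divide field_simps)
qed

lemma Lp_norm_test_function:
  assumes \<Omega>: "open (\<Omega> :: (real^2) set)" and u: "u \<in> test_functions \<Omega>" and r: "0 < r"
  shows "Lp_norm (ereal r) \<Omega> u = (\<integral>z. \<bar>u (of_pair z)\<bar> powr r \<partial>lborel) powr (1 / r)"
    and "Lp_norm (ereal r) \<Omega> (gradient u) = (\<integral>z. norm (gradient u (of_pair z)) powr r \<partial>lborel) powr (1 / r)"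
proof -
  note C = C1_compact_test_function[OF u]
  have c: "continuous_on UNIV u" "continuous_on UNIV (\<lambda>x. norm (gradient u x))"
    using continuous_on_compose2[OF C1_compact_continuous[OF C] continuous_to_pair]
      continuous_on_compose2[OF C1_compact_continuous_grad[OF C] continuous_to_pair] by simp_all
  have m: "(\<lambda>x. \<bar>u x\<bar> powr r) \<in> borel_measurable borel"
    "(\<lambda>x. norm (gradient u x) powr r) \<in> borel_measurable borel"
    using c[THEN borel_measurable_continuous_onI] by measurable
  show "Lp_norm (ereal r) \<Omega> u = (\<integral>z. \<bar>u (of_pair z)\<bar> powr r \<partial>lborel) powr (1 / r)"
    using test_function_zero_outside(1)[OF u] integral_lebesgue_on_of_pair[OF m(1) \<Omega>]
    by (simp add: Lp_norm_def)
  show "Lp_norm (ereal r) \<Omega> (gradient u) = (\<integral>z. norm (gradient u (of_pair z)) powr r \<partial>lborel) powr (1 / r)"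
    using test_function_zero_outside(2)[OF u] integral_lebesgue_on_of_pair[OF m(2) \<Omega>]
    by (simp add: Lp_norm_def)
qed

text \<open>Keeps the denominator of the Rayleigh quotient away from 0, where division would return
  0 and the lower bound would fail.\<close>

lemma integral_powr_pos:
  fixes h :: "'a::euclidean_space \<Rightarrow> real"
  assumes h: "continuous_on UNIV h" "bounded {z. h z \<noteq> 0}" and r: "0 < r" and z: "h z \<noteq> 0"
  shows "0 < (\<integral>z. \<bar>h z\<bar> powr r \<partial>lborel)"
proof (rule ccontr)
  have int: "integrable lborel (\<lambda>z. \<bar>h z\<bar> powr r)"
    by (rule integrable_powr_bounded_support[OF h r])
  assume "\<not> 0 < (\<integral>z. \<bar>h z\<bar> powr r \<partial>lborel)"
  moreover have "0 \<le> (\<integral>z. \<bar>h z\<bar> powr r \<partial>lborel)"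
    by (rule Bochner_Integration.integral_nonneg) simp
  ultimately have "(\<integral>z. \<bar>h z\<bar> powr r \<partial>lborel) = 0"
    by linarith
  then have "AE z in lborel. \<bar>h z\<bar> powr r = 0"
    using int by (simp add: integral_nonneg_eq_0_iff_AE)
  then have "AE z in lborel. z \<notin> {z. h z \<noteq> 0}"
    by simp
  moreover have o: "open {z. h z \<noteq> 0}"
    using h by (intro open_Collect_neq continuous_intros)
  ultimately have "{z. h z \<noteq> 0} \<in> null_sets lborel"
    by (subst AE_iff_null_sets) auto
  then have "emeasure lborel {z. h z \<noteq> 0} = 0"
    by (rule null_setsD1)
  moreover obtain e where e: "0 < e" "ball z e \<subseteq> {z. h z \<noteq> 0}"
    using o z open_contains_ball by blast
  ultimately have "emeasure lborel (ball z e) = 0"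
    using emeasure_mono[OF e(2), of lborel] o by simp
  then show False
    using content_ball_pos[OF e(1), of z] by (simp add: measure_def)
qed

lemma Lp_norm_infinity:
  assumes \<Omega>: "open (\<Omega> :: (real^2) set)" and u: "u \<in> test_functions \<Omega>" "u \<noteq> (\<lambda>x. 0)"
    and B: "\<And>x. \<bar>u x\<bar> \<le> B"
  shows "0 < Lp_norm \<infinity> \<Omega> u" "Lp_norm \<infinity> \<Omega> u \<le> B"
proof -
  define M where "M = lebesgue_on \<Omega>"
  define s where "s = esssup M (\<lambda>x. ereal (norm (u x)))"
  have cu: "continuous_on UNIV u"
    using continuous_on_compose2[OF C1_compact_continuous[OF C1_compact_test_function[OF u(1)]] continuous_to_pair]
    by simp
  have m: "(\<lambda>x. ereal (norm (u x))) \<in> borel_measurable M"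
  proof -
    have "u \<in> borel_measurable M"
      unfolding M_def using cu by (intro continuous_imp_measurable_on_sets_lebesgue) (use \<Omega> in \<open>auto intro: continuous_on_subset\<close>)
    then show ?thesis by simp
  qed
  have le: "s \<le> ereal B"
    unfolding s_def using m B by (intro esssup_I) auto
  obtain x where x: "u x \<noteq> 0" using u(2) by auto
  define U where "U = {y. \<bar>u x\<bar> / 2 < \<bar>u y\<bar>}"
  have oU: "open U"
    unfolding U_def using cu by (intro open_Collect_less continuous_intros)
  have U: "U \<subseteq> \<Omega>" "x \<in> U"
    using test_function_zero_outside(1)[OF u(1)] x by (fastforce simp: U_def)+
  have "ereal (\<bar>u x\<bar> / 2) \<le> s"
  proof (rule ccontr)
    assume "\<not> ereal (\<bar>u x\<bar> / 2) \<le> s"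
    then have s: "s < ereal (\<bar>u x\<bar> / 2)" by simp
    have "AE y in M. ereal (norm (u y)) \<le> s"
      unfolding s_def by (rule esssup_AE)
    then have "AE y in M. ereal (norm (u y)) < ereal (\<bar>u x\<bar> / 2)"
      by eventually_elim (rule order.strict_trans1[OF _ s])
    then have "AE y in M. y \<notin> U"
      by (auto elim!: eventually_mono simp: U_def)
    then have "AE y in lebesgue. y \<in> \<Omega> \<longrightarrow> y \<notin> U"
      unfolding M_def using \<Omega> by (subst (asm) AE_restrict_space_iff) auto
    then have "AE y in lebesgue. y \<notin> U"
      by eventually_elim (use U in auto)
    then have "emeasure lebesgue U = 0"
      using AE_iff_null_sets[of U lebesgue] oU by (auto simp: null_sets_def)
    moreover obtain e where e: "0 < e" "ball x e \<subseteq> U"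
      using oU U(2) open_contains_ball by blast
    ultimately have "emeasure lebesgue (ball x e) = 0"
      using emeasure_mono[OF e(2), of lebesgue] oU by simp
    then show False
      using content_ball_pos[OF e(1), of x] by (simp add: measure_def)
  qed
  then have "ereal (\<bar>u x\<bar> / 2) \<le> s" .
  \<comment> \<open>Both bounds are needed to know that \<open>s\<close> is finite, since
    \<open>real_of_ereal\<close> returns 0 at infinite values.\<close>
  with le have "\<bar>u x\<bar> / 2 \<le> real_of_ereal s \<and> real_of_ereal s \<le> B"
    by (cases s) auto
  then show "0 < Lp_norm \<infinity> \<Omega> u" "Lp_norm \<infinity> \<Omega> u \<le> B"
    using x by (auto simp: Lp_norm_def s_def M_def)
qed

text \<open>\<open>792 = 396 * 2\<close>, because the scale \<open>d\<close> of the holes is twice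
  the inradius.\<close>

lemma poincare_domain_of_pair:
  assumes k: "1 \<le> k" and \<Omega>: "multiply_connected_of_order k \<Omega>" "\<Omega> \<noteq> {}" "inradius \<Omega> < \<infinity>"
  shows "poincare_domain (of_pair -` \<Omega>) (792 * (sqrt (real k) * enn2real (inradius \<Omega>)))"
proof
  interpret perforated_plane "of_pair -` \<Omega>" k "2 * enn2real (inradius \<Omega>)"
    by (rule perforated_plane_of_pair(2)[OF \<Omega>])
  show "0 < 792 * (sqrt (real k) * enn2real (inradius \<Omega>))"
    using k perforated_plane_of_pair(1)[OF \<Omega>] by simp
  fix f g assume "C1_compact f g" "\<And>z. z \<notin> of_pair -` \<Omega> \<Longrightarrow> f z = 0"
  from poincare[OF k this]
  show "(\<integral>\<^sup>+z. ennreal \<bar>f z\<bar> \<partial>lborel)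
      \<le> ennreal (792 * (sqrt (real k) * enn2real (inradius \<Omega>))) * (\<integral>\<^sup>+z. ennreal (g z) \<partial>lborel)"
    by (simp add: mult_ac)
qed

text \<open>The Poincare constant is \<open>792 * R\<close> with \<open>R = sqrt k * inradius\<close>; the exponent of \<open>R\<close> is at
  most 1, so the power of 792 is at most 792. The value 31680 is \<open>40 * 792\<close>.\<close>

definition sobolev_const :: "real \<Rightarrow> ereal \<Rightarrow> real" where
  "sobolev_const p q =
     (if q = \<infinity> then (1 + sqrt 8 * (p powr p) powr ((1 - 2 / p) / 2) / (1 - 2 powr (- (1 - 2 / p) / 2)))
          * 792 powr (1 - 2 / p)
      else if p = 2 then 31680 * sqrt (real_of_ereal q)
      else 792 * (1 + real_of_ereal q * (1 - 1 / p)))"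

lemma sobolev_const_pos:
  assumes "admissible p q"
  shows "0 < sobolev_const p q"
proof (cases q)
  case (real r)
  then show ?thesis
    using assms by (auto simp: admissible_def sobolev_const_def intro!: add_pos_nonneg)
next
  case PInf
  then have p: "2 < p"
    using assms by (auto simp: admissible_def not_less intro: ccontr)
  then have "2 powr (- (1 - 2 / p) / 2) < (1 :: real)"
    by (intro powr_less_one) auto
  then show ?thesis
    using PInf p by (auto simp: sobolev_const_def intro!: add_pos_nonneg mult_pos_pos)
qed (use assms in \<open>auto simp: admissible_def\<close>)

theorem sobolev_test_function:
  assumes adm: "admissible p q" and k: "1 \<le> k"
    and \<Omega>: "multiply_connected_of_order k \<Omega>" "inradius \<Omega> < \<infinity>"
    and u: "u \<in> test_functions \<Omega>" "u \<noteq> (\<lambda>x. 0)"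
  shows "0 < Lp_norm q \<Omega> u"
    and "0 < sqrt (real k) * enn2real (inradius \<Omega>)"
    and "Lp_norm q \<Omega> u \<le> sobolev_const p q
      * (sqrt (real k) * enn2real (inradius \<Omega>)) powr (1 - 2 / p + 2 * real_of_ereal (1 / q))
      * Lp_norm (ereal p) \<Omega> (gradient u)"
proof -
  define R where "R = sqrt (real k) * enn2real (inradius \<Omega>)"
  define f where "f z = u (of_pair z)" for z
  define g where "g z = norm (gradient u (of_pair z))" for z
  have op: "open \<Omega>" using \<Omega>(1) by (simp add: multiply_connected_of_order_def)
  obtain x where x: "u x \<noteq> 0" using u(2) by auto
  then have ne: "\<Omega> \<noteq> {}" using test_function_zero_outside(1)[OF u(1)] by blast
  interpret poincare_domain "of_pair -` \<Omega>" "792 * R"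
    unfolding R_def by (rule poincare_domain_of_pair[OF k \<Omega>(1) ne \<Omega>(2)])
  have R: "0 < R" using a_pos by simp
  then show "0 < sqrt (real k) * enn2real (inradius \<Omega>)" by (simp add: R_def)
  have fg: "C1_compact f g"
    unfolding f_def[abs_def] g_def[abs_def] by (rule C1_compact_test_function[OF u(1)])
  have f0: "f z = 0" if "z \<notin> of_pair -` \<Omega>" for z
    using that test_function_zero_outside(1)[OF u(1)] by (simp add: f_def)
  have fx: "f (to_pair x) \<noteq> 0" using x by (simp add: f_def)
  have pos: "0 < (\<integral>z. \<bar>f z\<bar> powr r \<partial>lborel)" if "0 < r" for r
    by (rule integral_powr_pos[OF C1_compact_continuous[OF fg] C1_compact_bounded[OF fg] that fx])
  have p: "1 \<le> p" using adm by (simp add: admissible_def)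
  have Lp: "Lp_norm (ereal p) \<Omega> (gradient u) = (\<integral>z. g z powr p \<partial>lborel) powr (1 / p)"
    using Lp_norm_test_function(2)[OF op u(1), of p] p by (simp add: g_def)
  have Lp0: "0 \<le> Lp_norm (ereal p) \<Omega> (gradient u)"
    by (simp add: Lp_norm_def)
  have "0 < Lp_norm q \<Omega> u \<and> Lp_norm q \<Omega> u \<le> sobolev_const p q
      * R powr (1 - 2 / p + 2 * real_of_ereal (1 / q)) * Lp_norm (ereal p) \<Omega> (gradient u)"
  proof (cases q)
    case (real r)
    then have r: "p \<le> r" "0 < r" using adm p by (auto simp: admissible_def)
    have e: "real_of_ereal (1 / q) = 1 / r"
      using real r by (simp add: one_ereal_def)
    have Lq: "Lp_norm q \<Omega> u = (\<integral>z. \<bar>f z\<bar> powr r \<partial>lborel) powr (1 / r)"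
      using Lp_norm_test_function(1)[OF op u(1) r(2)] real by (simp add: f_def)
    have scale: "(792 * R) powr t \<le> 792 * R powr t" if "0 \<le> t" "t \<le> 1" for t
    proof -
      have "(792 :: real) powr t \<le> 792 powr 1"
        using that by (intro powr_mono) auto
      then show ?thesis using R by (simp add: powr_mult)
    qed
    have "Lp_norm q \<Omega> u \<le> sobolev_const p q * R powr (1 - 2 / p + 2 / r) * Lp_norm (ereal p) \<Omega> (gradient u)"
    proof (cases "p = 2")
      case True
      have "Lp_norm q \<Omega> u \<le> 40 * sqrt r * (792 * R) powr (2 / r) * Lp_norm (ereal p) \<Omega> (gradient u)"
        using trudinger[OF fg f0, of r] r True unfolding Lq Lp by simp
      also have "\<dots> \<le> 40 * sqrt r * (792 * R powr (2 / r)) * Lp_norm (ereal p) \<Omega> (gradient u)"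
        using scale[of "2 / r"] r True by (intro mult_right_mono mult_left_mono Lp0) auto
      finally show ?thesis
        using True real by (simp add: sobolev_const_def mult_ac)
    next
      case False
      define t where "t = 1 - 2 / p + 2 / r"
      \<comment> \<open>The upper bound is \<open>p \<le> q\<close>. For \<open>p < 2\<close> the
        lower bound is subcriticality; for larger \<open>p\<close> it is automatic.\<close>
      have t: "0 \<le> t" "t \<le> 1"
      proof -
        show "t \<le> 1" using r p by (simp add: t_def divide_left_mono)
        show "0 \<le> t"
        proof (cases "p < 2")
          case True
          then have "r < 2 * p / (2 - p)"
            using adm real by (simp add: admissible_def p_star_def)
          then show ?thesis
            using True r p by (simp add: t_def field_simps)
        next
          case False
          then have "2 / p \<le> 1" "0 < 2 / r" using r by auto
          then show ?thesis by (simp add: t_def)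
        qed
      qed
      have "Lp_norm q \<Omega> u \<le> (1 + r * (1 - 1 / p)) * (792 * R) powr t * Lp_norm (ereal p) \<Omega> (gradient u)"
        using poincare_sobolev[OF fg f0 p r(1)] t unfolding Lq Lp t_def by simp
      also have "\<dots> \<le> (1 + r * (1 - 1 / p)) * (792 * R powr t) * Lp_norm (ereal p) \<Omega> (gradient u)"
        using scale[OF t] r p by (intro mult_right_mono mult_left_mono Lp0) auto
      finally have "Lp_norm q \<Omega> u \<le> (1 + r * (1 - 1 / p)) * (792 * R powr t) * Lp_norm (ereal p) \<Omega> (gradient u)" .
      moreover have "sobolev_const p q = 792 * (1 + r * (1 - 1 / p))"
        using False real by (simp add: sobolev_const_def)
      ultimately show ?thesis
        by (simp only: t_def mult_ac)
    qed
    moreover have "0 < Lp_norm q \<Omega> u"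
      using pos[OF r(2)] by (simp add: Lq)
    ultimately show ?thesis
      by (simp add: e)
  next
    case PInf
    then have p2: "2 < p"
      using adm by (auto simp: admissible_def not_less intro: ccontr)
    \<comment> \<open>If the gradient integral vanished, the inequality for \<open>q = p\<close>
      would force \<open>f\<close> to vanish; so \<open>sup_bound\<close> is applicable.\<close>
    have "0 < (\<integral>z. \<bar>f z\<bar> powr p \<partial>lborel) powr (1 / p)"
      using pos[of p] p by simp
    also have "\<dots> \<le> (1 + p * (1 - 1 / p)) * (792 * R) powr (1 - 2 / p + 2 / p) * (\<integral>z. g z powr p \<partial>lborel) powr (1 / p)"
      using poincare_sobolev[OF fg f0 p order_refl] by simp
    finally have "(\<integral>z. g z powr p \<partial>lborel) \<noteq> 0"
      by auto
    then have G0: "0 < (\<integral>z. g z powr p \<partial>lborel)"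
      by (simp add: less_le)
    have bd: "\<bar>u y\<bar> \<le> sobolev_const p q * R powr (1 - 2 / p) * Lp_norm (ereal p) \<Omega> (gradient u)" for y
      using sup_bound[OF fg f0 p2 G0, of "to_pair y"] R PInf
      by (simp add: Lp f_def sobolev_const_def powr_mult mult_ac)
    then show ?thesis
      using Lp_norm_infinity[OF op u bd] PInf by simp
  qed (use adm in \<open>auto simp: admissible_def\<close>)
  then show "0 < Lp_norm q \<Omega> u" "Lp_norm q \<Omega> u \<le> sobolev_const p q
      * (sqrt (real k) * enn2real (inradius \<Omega>)) powr (1 - 2 / p + 2 * real_of_ereal (1 / q))
      * Lp_norm (ereal p) \<Omega> (gradient u)"
    by (simp_all add: R_def)
qed

text \<open>The witness \<open>sobolev_const p q powr (- p)\<close> is an explicit function of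
  \<open>p\<close> and \<open>q\<close>, so (a) and (b) become limits of elementary
  expressions.\<close>

theorem theorem3p4:
  shows "\<exists>\<Theta> :: real \<Rightarrow> ereal \<Rightarrow> real.
    (\<forall>p q. admissible p q \<longrightarrow>
       \<Theta> p q > 0 \<and>
       (\<forall>(k::nat) (\<Omega>::(real^2) set).
          k \<ge> 1 \<longrightarrow> multiply_connected_of_order k \<Omega> \<longrightarrow> inradius \<Omega> < \<infinity> \<longrightarrow>
          lambda_pq p q \<Omega> \<ge>
            ereal (\<Theta> p q * (1 / (sqrt (real k) * enn2real (inradius \<Omega>)))
                     powr (p - 2 + 2 * p * real_of_ereal (1 / q))))) \<and>
    (\<forall>p. 1 \<le> p \<and> p < 2 \<longrightarrow>
       (\<exists>L>0. ((\<lambda>q::real. \<Theta> p (ereal q)) \<longlongrightarrow> L) (at_left (p_star p)))) \<and>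
    0 < Liminf at_top (\<lambda>q::real. ereal (q * \<Theta> 2 (ereal q))) \<and>
    Liminf at_top (\<lambda>q::real. ereal (q * \<Theta> 2 (ereal q)))
      \<le> Limsup at_top (\<lambda>q::real. ereal (q * \<Theta> 2 (ereal q))) \<and>
    Limsup at_top (\<lambda>q::real. ereal (q * \<Theta> 2 (ereal q))) < \<infinity>"
proof (intro exI[of _ "\<lambda>p q. sobolev_const p q powr (- p)"] conjI allI impI)
  fix p q assume adm: "admissible p q"
  then show "0 < sobolev_const p q powr (- p)"
    using sobolev_const_pos by fastforce
  fix k :: nat and \<Omega> :: "(real^2) set"
  assume k: "1 \<le> k" and \<Omega>: "multiply_connected_of_order k \<Omega>" "inradius \<Omega> < \<infinity>"
  have p: "1 \<le> p" using adm by (simp add: admissible_def)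
  show "ereal (sobolev_const p q powr (- p) * (1 / (sqrt (real k) * enn2real (inradius \<Omega>)))
      powr (p - 2 + 2 * p * real_of_ereal (1 / q))) \<le> lambda_pq p q \<Omega>"
    unfolding lambda_pq_def
  \<comment> \<open>An empty \<Omega> has no nonzero test function, its infimum is \<infinity>, and
    nothing is left to show; a nonzero \<open>u\<close> guarantees a positive inradius.\<close>
  proof (rule INF_greatest)
    fix u assume "u \<in> test_functions \<Omega> - {\<lambda>x. 0}"
    then have u: "u \<in> test_functions \<Omega>" "u \<noteq> (\<lambda>x. 0)" by auto
    have e: "p * (1 - 2 / p + 2 * real_of_ereal (1 / q)) = p - 2 + 2 * p * real_of_ereal (1 / q)"
      using p by (simp add: algebra_simps)
    have "0 \<le> Lp_norm (ereal p) \<Omega> (gradient u)"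
      by (simp add: Lp_norm_def)
    from rayleigh_lower_bound[where p = p, OF sobolev_test_function(1)[OF adm k \<Omega> u] this
        sobolev_test_function(2)[OF adm k \<Omega> u] sobolev_const_pos[OF adm] _
        sobolev_test_function(3)[OF adm k \<Omega> u]]
    show "ereal (sobolev_const p q powr (- p) * (1 / (sqrt (real k) * enn2real (inradius \<Omega>)))
        powr (p - 2 + 2 * p * real_of_ereal (1 / q)))
      \<le> ereal (Lp_norm (ereal p) \<Omega> (gradient u) powr p / Lp_norm q \<Omega> u powr p)"
      using p unfolding e by simp
  qed
next
  fix p :: real assume p: "1 \<le> p \<and> p < 2"
  \<comment> \<open>The formula for \<open>p < 2\<close> is continuous and positive up to and
    including \<open>p_star p\<close>, so the limit is its value there.\<close>
  define c where "c q = 792 * (1 + q * (1 - 1 / p))" for q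
  have c: "0 < c (p_star p)"
    using p by (auto simp: c_def p_star_def intro!: add_pos_nonneg)
  have "((\<lambda>q. c q powr (- p)) \<longlongrightarrow> c (p_star p) powr (- p)) (at_left (p_star p))"
    using c unfolding c_def by (intro tendsto_intros) auto
  then show "\<exists>L>0. ((\<lambda>q. sobolev_const p (ereal q) powr (- p)) \<longlongrightarrow> L) (at_left (p_star p))"
    using c p by (intro exI[of _ "c (p_star p) powr (- p)"]) (auto simp: sobolev_const_def c_def)
next
  \<comment> \<open>The growth \<open>sqrt q\<close> of the Sobolev constant, squared and inverted,
    cancels \<open>q\<close> exactly, so both limits are those of a positive constant.\<close>
  have ev: "\<forall>\<^sub>F q in at_top. ereal (q * sobolev_const 2 (ereal q) powr (- 2)) = ereal (1 / 31680\<^sup>2)"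
    using eventually_gt_at_top[of 0]
  proof eventually_elim
    case (elim q)
    then show ?case
      by (simp add: sobolev_const_def powr_minus_divide powr_mult power_mult_distrib)
  qed
  show "0 < Liminf at_top (\<lambda>q. ereal (q * sobolev_const 2 (ereal q) powr (- 2)))"
    unfolding Liminf_eq[OF ev] by (simp add: Liminf_const)
  show "Liminf at_top (\<lambda>q. ereal (q * sobolev_const 2 (ereal q) powr (- 2)))
      \<le> Limsup at_top (\<lambda>q. ereal (q * sobolev_const 2 (ereal q) powr (- 2)))"
    by (rule Liminf_le_Limsup) simp
  show "Limsup at_top (\<lambda>q. ereal (q * sobolev_const 2 (ereal q) powr (- 2))) < \<infinity>"
    unfolding Limsup_eq[OF ev] by (simp add: Limsup_const)
qed

end
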